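(* Let $k\ge3$, $k\in\{2p-1,2p\}$, and let $J$ be a Jacobi operator with perturbation $q\in\mathfrak X_k$. Let $\{r_n\}_1^k$ be the roots (with multiplicity) of its Jost function $\psi_0$, and let $-1<s_{-n_-}<\dots<s_{-1}<0<s_1<\dots<s_{n_+}<1$ be the roots lying in $\mathbb D=\{|z|<1\}$. Let $(r,\mathfrak s)$ be a pair satisfying one of the following conditions: i) $r$ is a non-real resonance and $\mathfrak s=\bar r$; ii) $r$ is a resonance from the interval $(s_{j+1}^{-1},s_{j-1}^{-1})$ for some $j\in\{2,3,\dots,n_+-1\}$, or $r$ is a resonance from the interval $(1,s_{n_+-1}^{-1})$ and $j=n_+$; in both cases $\mathfrak s=s_j$. Then the pair $(r,\mathfrak s)$ can be moved to any pair $(r_\bullet,\mathfrak s_\bullet)$ of points in $\mathbb R\setminus[s_{-1}^{-1},s_1^{-1}]$ or to any two complex conjugate points $r_\bullet,\mathfrak s_\bullet$ of $\mathbb C\setminus(\mathbb R\cup\overline{\mathbb D})$: there exists a Jacobi operator $\widetilde J$ with perturbation $\widetilde q=q(\widetilde a,\widetilde b)\in\mathfrak X_k$ whose Jost function has the set of roots $(\{r_n\}_1^k\setminus\{r,\mathfrak s\})\cup\{r_\bullet,\mathfrak s_\bullet\}$. There also exists a Jacobi operator $J_o$ with perturbation $q_o=q(a^o,b^o)\in\mathfrak X_{k-2}$ whose Jost function has the roots $\{r_n\}_1^k\setminus\{r,\mathfrak s\}$. In particular, put $\mathfrak a=r_\bullet\mathfrak s_\bullet$. If $k=2p$ (i.e.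 $a_p\ne1$), then $$\widetilde a_p=1-\frac{1-(a^o_{p-1})^2+o(1)}{2|\mathfrak a|}\qquad\text{as }|\mathfrak a|\to+\infty .$$ If $k=2p-1$ (i.e. $a_p=1$, $b_p\ne0$), then $$\widetilde b_p=\frac{b^o_{p-1}}{|\mathfrak a|}\to0\qquad\text{as }|\mathfrak a|\to+\infty .$$ Moreover, in both cases $\widetilde q\to q_o$ as $|\mathfrak a|\to\infty$.
   Context: $\mathbb N=\{1,2,\dots\}$. For real bounded sequences $(a_x)_{x\ge1}$, $(b_x)_{x\ge1}$ with $a_x>0$, the Jacobi operator $J$ on $\ell^2(\mathbb N)$ is $(Jf)_x=a_xf_{x+1}+b_xf_x+a_{x-1}f_{x-1}$, $x\ge1$, with $f_0=0$ formally and $a_0=1$. Its perturbation is $q=q(a,b)=(b_1,a_1-1,b_2,a_2-1,\dots)$. For $k\in\mathbb N$, $\mathfrak X_k=\{h\in\ell^\infty(\mathbb N)\ \text{real}:\ h_{2x}>-1\ \forall x\in\mathbb N,\ h_k\ne0,\ h_x=0\ \forall x>k\}$. So if $k\in\{2p-1,2p\}$ then $a_x=1,b_x=0$ for $x>p$; if $k=2p-1$ then $a_p=1,b_p\neq0$; if $k=2p$ then $a_p\ne1$. The Jost solution $(\psi_x(z))_{x\ge0}$, $z\ne0$, is defined by $a_{x-1}\psi_{x-1}+a_x\psi_{x+1}+b_x\psi_x=(z+z^{-1})\psi_x$ for $x\ge1$ and $\psi_x(z)=z^x$ for $x>p$. The Jost function $\psi_0$ is a real polynomial of degree $k$ with $\psi_0(0)>0$;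 its zeros in $\mathbb D$ are real and simple (they correspond to the eigenvalues $s_j+1/s_j$ of $J$), and its zeros in $\mathbb C\setminus\mathbb D$ are called resonances. Sets of roots are multisets, and $\setminus$ removes one copy of each listed root. If $\psi_0$ has no positive (negative) root in $\mathbb D$, then $s_1$ ($s_{-1}$) is replaced by $1$ ($-1$) in $[s_{-1}^{-1},s_1^{-1}]$. Convergence of perturbations is in $\ell^\infty(\mathbb N)$ (equivalently coordinatewise).
   Formalization: In both asymptotic formulas |𝔞| is replaced by the signed product 𝔞 = r_•𝔰_• (the formulas fail for real points of opposite sign), and q̃→q_o is stated as both r_• and 𝔰_• tend to infinity (it fails if one stays bounded while |𝔞|→∞). *)

theory Defs
  imports "HOL-Analysis.Analysis" "HOL-Computational_Algebra.Computational_Algebra"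
begin

text \<open>
  Sequences indexed by $\{1,2,\dots\}$ are functions on \<^typ>\<open>nat\<close>.  A Jacobi operator is
  given by its coefficients \<open>a\<close>, \<open>b\<close>; index 0 carries the convention \<open>a 0 = 1\<close>, and \<open>b 0\<close> is
  never used.
\<close>

definition jacobi_coeffs :: "(nat \<Rightarrow> real) \<Rightarrow> (nat \<Rightarrow> real) \<Rightarrow> bool" where
  "jacobi_coeffs a b \<longleftrightarrow> a 0 = 1 \<and> (\<forall>x\<ge>1. a x > 0) \<and> bounded (a ` {1..}) \<and> bounded (b ` {1..})"

text \<open>The difference expression of the Jacobi operator.  On \<open>f\<close> with \<open>f 0 = 0\<close> it is the operator
  itself; the Jost solution below satisfies the same expression with \<open>f 0\<close> arbitrary.\<close>

definition jacobi_expr ::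
  "(nat \<Rightarrow> real) \<Rightarrow> (nat \<Rightarrow> real) \<Rightarrow> (nat \<Rightarrow> complex) \<Rightarrow> nat \<Rightarrow> complex" where
  "jacobi_expr a b f x = a x * f (x + 1) + b x * f x + a (x - 1) * f (x - 1)"

text \<open>\<open>perturbation a b = (b 1, a 1 - 1, b 2, a 2 - 1, \<dots>)\<close> at the indices 1, 2, 3, 4, \dots\<close>

definition perturbation :: "(nat \<Rightarrow> real) \<Rightarrow> (nat \<Rightarrow> real) \<Rightarrow> nat \<Rightarrow> real" where
  "perturbation a b x = (if even x then a (x div 2) - 1 else b ((x + 1) div 2))"

definition pert_class :: "nat \<Rightarrow> (nat \<Rightarrow> real) set" where
  "pert_class k =
     {h. bounded (h ` {1..}) \<and> (\<forall>x\<ge>1. h (2 * x) > -1) \<and> h k \<noteq> 0 \<and> (\<forall>x>k. h x = 0)}"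

definition jost_solution ::
  "(nat \<Rightarrow> real) \<Rightarrow> (nat \<Rightarrow> real) \<Rightarrow> nat \<Rightarrow> complex \<Rightarrow> (nat \<Rightarrow> complex) \<Rightarrow> bool" where
  "jost_solution a b p z \<psi> \<longleftrightarrow>
     (\<forall>x\<ge>1. jacobi_expr a b \<psi> x = (z + inverse z) * \<psi> x) \<and> (\<forall>x>p. \<psi> x = z ^ x)"

text \<open>The Jost function $\psi_0$ as a polynomial.  It is well defined by lemma
  \<open>jost_function_unique\<close> below.\<close>

definition jost_function :: "(nat \<Rightarrow> real) \<Rightarrow> (nat \<Rightarrow> real) \<Rightarrow> nat \<Rightarrow> complex poly" where
  "jost_function a b p =
     (THE P. \<forall>z. z \<noteq> 0 \<longrightarrow> (\<exists>\<psi>. jost_solution a b p z \<psi> \<and> poly P z = \<psi> 0))"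

text \<open>\<open>has_jost_roots k a b R\<close>: the Jacobi operator has perturbation in \<open>pert_class k\<close>, and the
  roots of its Jost function, with multiplicity, are \<open>R\<close>.  Here \<open>p = (k + 1) div 2\<close>, i.e.
  \<open>k = 2 * p - 1\<close> or \<open>k = 2 * p\<close>.\<close>

definition has_jost_roots ::
  "nat \<Rightarrow> (nat \<Rightarrow> real) \<Rightarrow> (nat \<Rightarrow> real) \<Rightarrow> complex multiset \<Rightarrow> bool" where
  "has_jost_roots k a b R \<longleftrightarrow>
     jacobi_coeffs a b \<and> perturbation a b \<in> pert_class k \<and>
     proots (jost_function a b ((k + 1) div 2)) = R"

definition resonance :: "complex poly \<Rightarrow> complex \<Rightarrow> bool" where
  "resonance P r \<longleftrightarrow> poly P r = 0 \<and> norm r \<ge> 1"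

text \<open>\<open>disc_roots P nm np s\<close>: the roots of \<open>P\<close> in the open unit disc are
  \<open>-1 < s (-nm) < \<dots> < s (-1) < 0 < s 1 < \<dots> < s np < 1\<close>.\<close>

definition disc_roots :: "complex poly \<Rightarrow> nat \<Rightarrow> nat \<Rightarrow> (int \<Rightarrow> real) \<Rightarrow> bool" where
  "disc_roots P nm np s \<longleftrightarrow>
     strict_mono_on ({- int nm..int np} - {0}) s \<and>
     s ` {- int nm..- 1} \<subseteq> {-1<..<0} \<and> s ` {1..int np} \<subseteq> {0<..<1} \<and>
     {z. poly P z = 0 \<and> norm z < 1} = (\<lambda>i. complex_of_real (s i)) ` ({- int nm..int np} - {0})"

definition lower_end :: "nat \<Rightarrow> (int \<Rightarrow> real) \<Rightarrow> real" where
  "lower_end nm s = (if nm = 0 then -1 else inverse (s (-1)))"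

definition upper_end :: "nat \<Rightarrow> (int \<Rightarrow> real) \<Rightarrow> real" where
  "upper_end np s = (if np = 0 then 1 else inverse (s 1))"

definition target_pairs :: "nat \<Rightarrow> nat \<Rightarrow> (int \<Rightarrow> real) \<Rightarrow> (complex \<times> complex) set" where
  "target_pairs nm np s =
     {(complex_of_real x, complex_of_real y) | x y.
        x \<notin> {lower_end nm s..upper_end np s} \<and> y \<notin> {lower_end nm s..upper_end np s}} \<union>
     {(w, cnj w) | w. w \<notin> \<real> \<and> 1 < norm w}"

text \<open>The product of the two points of a target pair; for such pairs it is a real number,
  negative exactly for two real points of opposite sign.\<close>

definition pair_prod :: "complex \<times> complex \<Rightarrow> real" where
  "pair_prod t = Re (fst t * snd t)"

text \<open>Limits over a set \<open>T\<close> of pairs: \<open>prod_at_infinity T\<close> is the limit in which the modulus of the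
  product tends to infinity, \<open>both_at_infinity T\<close> the one in which both points tend to infinity.
  On pairs of complex conjugate points the two coincide; on real pairs the modulus of the product
  also tends to infinity when one point stays fixed.\<close>

definition prod_at_infinity :: "(complex \<times> complex) set \<Rightarrow> (complex \<times> complex) filter" where
  "prod_at_infinity T = inf (filtercomap (\<lambda>t. \<bar>pair_prod t\<bar>) at_top) (principal T)"

definition both_at_infinity :: "(complex \<times> complex) set \<Rightarrow> (complex \<times> complex) filter" where
  "both_at_infinity T =
     inf (filtercomap (\<lambda>t. min (norm (fst t)) (norm (snd t))) at_top) (principal T)"


lemma jost_solution_unique:
  assumes a: "a 0 = 1" "\<And>x. x \<ge> 1 \<Longrightarrow> a x > 0"
    and "jost_solution a b p z \<psi>" "jost_solution a b p z \<phi>"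
  shows "\<psi> = \<phi>"
proof -
  have pos: "a x \<noteq> 0" for x using a(1) a(2)[of x] by (cases "x = 0") auto
  have A: "\<forall>x. x + n > p \<longrightarrow> \<psi> x = \<phi> x" for n
  proof (induction n)
    case 0 then show ?case using assms by (simp add: jost_solution_def)
  next
    case (Suc n)
    show ?case
    proof (intro allI impI)
      fix x assume x: "x + Suc n > p"
      have "\<psi> (Suc x) = \<phi> (Suc x)" "\<psi> (Suc (Suc x)) = \<phi> (Suc (Suc x))"
        using Suc x by auto
      moreover have "jacobi_expr a b \<psi> (Suc x) = (z + inverse z) * \<psi> (Suc x)"
        "jacobi_expr a b \<phi> (Suc x) = (z + inverse z) * \<phi> (Suc x)"
        using assms(3,4) by (auto simp: jost_solution_def)
      ultimately have "complex_of_real (a x) * \<psi> x = complex_of_real (a x) * \<phi> x"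
        by (simp only: jacobi_expr_def diff_Suc_1 Suc_eq_plus1[symmetric]) (metis add_left_cancel)
      then show "\<psi> x = \<phi> x" using pos by simp
    qed
  qed
  show ?thesis using A[of "Suc p"] by (auto simp: fun_eq_iff)
qed

lemma jost_function_exists:
  assumes a: "a 0 = 1" "\<And>x. x \<ge> 1 \<Longrightarrow> a x > 0"
    and tail: "\<And>x. x > p \<Longrightarrow> a x = 1" "\<And>x. x > p \<Longrightarrow> b x = 0"
  shows "\<exists>P. \<forall>z. z \<noteq> 0 \<longrightarrow> (\<exists>\<psi>. jost_solution a b p z \<psi> \<and> poly P z = \<psi> 0)"
proof -
  have pos: "a x \<noteq> 0" for x using a(1) a(2)[of x] by (cases "x = 0") auto
  let ?rec = "\<lambda>Q :: nat \<Rightarrow> complex poly. \<lambda>x. \<forall>z.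
    of_real (a (x - 1)) * poly (Q (x - 1)) z + of_real (a x) * z^2 * poly (Q (x + 1)) z
      = (z^2 + 1 - of_real (b x) * z) * poly (Q x) z"
  have step: "\<exists>Q. (\<forall>x>p. Q x = 1) \<and> (\<forall>x\<ge>1. x + n > p + 1 \<longrightarrow> ?rec Q x)" for n
  proof (induction n)
    case 0
    show ?case by (rule exI[of _ "\<lambda>_. 1"]) (auto simp: tail)
  next
    case (Suc n)
    then obtain Q where Q: "\<forall>x>p. Q x = 1" "\<forall>x\<ge>1. x + n > p + 1 \<longrightarrow> ?rec Q x" by blast
    show ?case
    proof (cases "n \<le> p")
      case False
      then show ?thesis using Q by (intro exI[of _ Q]) auto
    next
      case True
      define y where "y = p - n"
      define R where "R = smult (of_real (inverse (a y)))
        ([:1, - of_real (b (Suc y)), 1:] * Q (Suc y)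
           - smult (of_real (a (Suc y))) ([:0, 0, 1:] * Q (Suc (Suc y))))"
      have "?rec (Q(y := R)) x" if x: "x \<ge> 1" "x + Suc n > p + 1" for x
      proof (cases "x = Suc y")
        case True
        then show ?thesis using pos[of y]
          by (simp add: R_def power2_eq_square field_simps)
      next
        case False
        then have "x > Suc y" using x \<open>n \<le> p\<close> by (simp add: y_def)
        moreover from this have "?rec Q x" using Q(2) x \<open>n \<le> p\<close> by (simp add: y_def)
        moreover from calculation(1) have "x - 1 \<noteq> y" "x \<noteq> y" "x + 1 \<noteq> y" by auto
        ultimately show ?thesis by simp
      qed
      moreover have "\<forall>x>p. (Q(y := R)) x = 1" using Q(1) by (auto simp: y_def)
      ultimately show ?thesis by blast
    qed
  qed
  obtain Q where Q: "\<forall>x>p. Q x = 1" "\<forall>x\<ge>1. x + Suc p > p + 1 \<longrightarrow> ?rec Q x"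
    using step[of "Suc p"] by blast
  have "jost_solution a b p z (\<lambda>x. z ^ x * poly (Q x) z)" if z: "z \<noteq> 0" for z
    unfolding jost_solution_def
  proof (intro conjI allI impI)
    fix x :: nat assume "x \<ge> 1"
    then obtain y where y: "x = Suc y" by (cases x) auto
    have r: "of_real (a y) * poly (Q y) z + of_real (a (Suc y)) * z^2 * poly (Q (Suc (Suc y))) z
      = (z^2 + 1 - of_real (b (Suc y)) * z) * poly (Q (Suc y)) z"
      using Q(2)[rule_format, of x] y by simp
    have "jacobi_expr a b (\<lambda>x. z ^ x * poly (Q x) z) x
      = z ^ y * (of_real (a y) * poly (Q y) z + of_real (a (Suc y)) * z^2 * poly (Q (Suc (Suc y))) z
          + of_real (b (Suc y)) * z * poly (Q (Suc y)) z)"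
      by (simp add: jacobi_expr_def y power2_eq_square algebra_simps)
    also have "\<dots> = z ^ y * (z^2 + 1) * poly (Q (Suc y)) z"
      unfolding r by (simp add: algebra_simps)
    also have "\<dots> = (z + inverse z) * (z ^ x * poly (Q x) z)"
      using z by (simp add: y power2_eq_square field_simps)
    finally show "jacobi_expr a b (\<lambda>x. z ^ x * poly (Q x) z) x
      = (z + inverse z) * (z ^ x * poly (Q x) z)" .
  qed (use Q in auto)
  then show ?thesis by (intro exI[of _ "Q 0"]) force
qed

lemma jost_function_unique:
  assumes "a 0 = 1" "\<And>x. x \<ge> 1 \<Longrightarrow> a x > 0"
    and "\<And>x. x > p \<Longrightarrow> a x = 1" "\<And>x. x > p \<Longrightarrow> b x = 0"
  shows "\<exists>!P. \<forall>z. z \<noteq> 0 \<longrightarrow> (\<exists>\<psi>. jost_solution a b p z \<psi> \<and> poly P z = \<psi> 0)"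
proof (rule ex_ex1I)
  show "\<exists>P. \<forall>z. z \<noteq> 0 \<longrightarrow> (\<exists>\<psi>. jost_solution a b p z \<psi> \<and> poly P z = \<psi> 0)"
    using jost_function_exists assms by blast
next
  fix P Q
  assume P: "\<forall>z. z \<noteq> 0 \<longrightarrow> (\<exists>\<psi>. jost_solution a b p z \<psi> \<and> poly P z = \<psi> 0)"
    and Q: "\<forall>z. z \<noteq> 0 \<longrightarrow> (\<exists>\<psi>. jost_solution a b p z \<psi> \<and> poly Q z = \<psi> 0)"
  have "poly P z = poly Q z" if "z \<noteq> 0" for z
    using P Q that jost_solution_unique[of a b p z] assms(1,2) by metis
  then have "- {0} \<subseteq> {z. poly (P - Q) z = 0}" by auto
  moreover have "infinite (- {0 :: complex})"
    by (simp add: Compl_eq_Diff_UNIV infinite_UNIV_char_0)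
  ultimately have "infinite {z. poly (P - Q) z = 0}" using finite_subset by blast
  then have "P - Q = 0" using poly_roots_finite by blast
  then show "P = Q" by simp
qed

lemma jost_function_eq:
  assumes "a 0 = 1" "\<And>x. x \<ge> 1 \<Longrightarrow> a x > 0"
    and "\<And>x. x > p \<Longrightarrow> a x = 1" "\<And>x. x > p \<Longrightarrow> b x = 0"
    and "z \<noteq> 0"
  shows "\<exists>\<psi>. jost_solution a b p z \<psi> \<and> poly (jost_function a b p) z = \<psi> 0"
  using theI'[OF jost_function_unique[of a p b]] assms
  unfolding jost_function_def by blast

end

theory Submission
  imports Defs "HOL-Complex_Analysis.Complex_Analysis"
begin

text \<open>
  Write \<open>w = z + 1/z\<close>, and let \<open>\<pi>\<^sub>n\<close> be the monic orthogonal polynomials of the Jacobi operator.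
  The Jost solution is free beyond \<open>p\<close>, so its Wronskian with the regular solution, evaluated at \<open>p\<close>,
  gives \<open>\<psi>\<^sub>0(z) = c z\<^sup>p (A(w) - z B(w))\<close> with \<open>A = \<pi>\<^sub>p\<close>, \<open>B = a\<^sub>p\<^sup>2 \<pi>\<^sub>p\<^sub>-\<^sub>1\<close> and \<open>1/c = a\<^sub>1 \<dots> a\<^sub>p\<close>.
  Every real polynomial \<open>f\<close> of degree at most \<open>2p\<close> can be written as \<open>z\<^sup>p (A(w) - z B(w))\<close> in exactly one way,
  so \<open>f\<close> is a Jost function up to a constant precisely when its two components \<open>A\<close>, \<open>B\<close> are consecutive
  orthogonal polynomials.

  The heart of the proof is that this can be read off from the roots: all roots in the closed unit disc
  are real, those in the open disc satisfy \<open>s f'(s) f(1/s) > 0\<close>, and those at \<open>\<plusminus>1\<close> are simple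
  (\<open>admissible\<close>).  Necessity (\<open>jost_poly_admissible\<close>) is an evaluation of \<open>s f'(s) f(1/s)\<close> in terms of
  the Wronskian \<open>A'B - AB'\<close>, which is positive as a sum of squares.  For sufficiency
  (\<open>admissible_imp_jost\<close>) the spectral measure is written down: the weight \<open>|1 - z\<^sup>2|\<^sup>2 / |f(z)|\<^sup>2\<close> on the
  circle together with a point mass at \<open>s + 1/s\<close> for each root \<open>s\<close> in the disc, the sign condition saying that
  these masses are positive.  The residue theorem shows that \<open>A\<close> and \<open>B\<close> are orthogonal to all
  polynomials of lower degree (\<open>spectral_functional\<close>), and dividing with remainder then produces the
  coefficients one after the other, each \<open>a\<^sub>n\<^sup>2\<close> with \<open>n < p\<close> being a quotient of two squared norms
  (\<open>favard_descent\<close>).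

  Now let \<open>c(z) = (1 - z/r)(1 - z/\<ss>)\<close> be the quadratic factor of a pair.  Dividing \<open>f\<close> by \<open>c\<close> or
  multiplying by it changes \<open>s f'(s) f(1/s)\<close> only by the factor \<open>c(s) c(1/s)\<close>, so a pair can be removed or
  added as soon as this number has the right sign at the remaining roots in the disc.  For conjugate
  pairs it is a product of squared absolute values, and for real pairs the intervals in the hypotheses
  are chosen to give it the right sign (\<open>removable_pair\<close>, \<open>target_pairD\<close>).

  Finally, let \<open>(A\<^sub>o, B\<^sub>o)\<close> and \<open>(A, B)\<close> be the components without and with the pair
  \<open>(r\<^sub>\<bullet>, \<ss>\<^sub>\<bullet>)\<close>, and put \<open>\<sigma> = 1/r\<^sub>\<bullet> + 1/\<ss>\<^sub>\<bullet>\<close>, \<open>\<mu> = 1/(r\<^sub>\<bullet> \<ss>\<^sub>\<bullet>)\<close>.  By uniqueness of the decomposition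
  \<open>A = (w - \<sigma>) A\<^sub>o - (1 - \<mu>) B\<^sub>o\<close> and \<open>B = (1 - \<mu>) A\<^sub>o + (\<mu> w - \<sigma>) B\<^sub>o\<close> (\<open>jost_poly_mult_quadratic\<close>).
  Comparing coefficients gives the formulas for the last coefficients \<open>a\<^sub>p\<close> and \<open>b\<^sub>p\<close>; as \<open>\<sigma>\<close> and \<open>\<mu>\<close> tend to 0,
  the pair \<open>(A, B)\<close> tends to \<open>(w A\<^sub>o - B\<^sub>o, A\<^sub>o)\<close>, the components of the limiting operator with one more
  free step, and the division algorithm is continuous (\<open>orth_poly_coeffs_tendsto\<close>).
\<close>

section \<open>Real polynomials as complex polynomials\<close>

abbreviation cpoly :: "real poly \<Rightarrow> complex poly" where
  "cpoly \<equiv> map_poly complex_of_real"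

lemma coeff_cpoly [simp]: "coeff (cpoly f) n = of_real (coeff f n)"
  by (simp add: coeff_map_poly)

lemma cpoly_add: "cpoly (f + g) = cpoly f + cpoly g"
  by (rule poly_eqI) simp

lemma cpoly_diff: "cpoly (f - g) = cpoly f - cpoly g"
  by (rule poly_eqI) simp

lemma cpoly_smult: "cpoly (smult c f) = smult (of_real c) (cpoly f)"
  by (rule poly_eqI) simp

lemma cpoly_mult: "cpoly (f * g) = cpoly f * cpoly g"
  by (rule poly_eqI) (simp add: coeff_mult)

lemma cpoly_pCons [simp]: "cpoly (pCons c f) = pCons (of_real c) (cpoly f)"
  by (rule map_poly_pCons) simp

lemmas cpoly_hom = cpoly_add cpoly_diff cpoly_smult cpoly_mult

lemma cpoly_inject [simp]: "cpoly f = cpoly g \<longleftrightarrow> f = g"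
  by (auto simp: poly_eq_iff)

lemma cpoly_eq_0_iff [simp]: "cpoly f = 0 \<longleftrightarrow> f = 0"
  by (auto simp: poly_eq_iff)

lemma degree_cpoly [simp]: "degree (cpoly f) = degree f"
  by (rule degree_map_poly) auto

lemma poly_cpoly_of_real [simp]: "poly (cpoly f) (of_real x) = of_real (poly f x)"
  by (induction f) auto

lemma poly_cpoly_cnj: "poly (cpoly f) (cnj z) = cnj (poly (cpoly f) z)"
  by (induction f) auto

lemma pderiv_cpoly: "pderiv (cpoly f) = cpoly (pderiv f)"
  by (rule poly_eqI) (simp add: coeff_pderiv)

section \<open>Orthogonal polynomials and the Jost function\<close>

fun orth_poly :: "(nat \<Rightarrow> real) \<Rightarrow> (nat \<Rightarrow> real) \<Rightarrow> nat \<Rightarrow> real poly" where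
  "orth_poly a b 0 = 1"
| "orth_poly a b (Suc 0) = [:- b 1, 1:]"
| "orth_poly a b (Suc (Suc n)) =
     [:- b (Suc (Suc n)), 1:] * orth_poly a b (Suc n) - smult ((a (Suc n))\<^sup>2) (orth_poly a b n)"

lemma orth_poly_cong:
  assumes "\<And>i. 1 \<le> i \<Longrightarrow> i < n \<Longrightarrow> a i = a' i" "\<And>i. 1 \<le> i \<Longrightarrow> i \<le> n \<Longrightarrow> b i = b' i"
  shows "orth_poly a b n = orth_poly a' b' n"
  using assms
proof (induction n rule: induct_nat_012)
  case (ge2 n)
  have "orth_poly a b (Suc n) = orth_poly a' b' (Suc n)" by (intro ge2.IH(2) ge2.prems) auto
  moreover have "orth_poly a b n = orth_poly a' b' n" by (intro ge2.IH(1) ge2.prems) auto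
  ultimately show ?case using ge2.prems(1)[of "Suc n"] ge2.prems(2)[of "Suc (Suc n)"] by simp
qed auto

lemma orth_poly_monic: "degree (orth_poly a b n) = n \<and> coeff (orth_poly a b n) n = 1"
proof (induction n rule: induct_nat_012)
  case (ge2 n)
  let ?P = "[:- b (Suc (Suc n)), 1:] * orth_poly a b (Suc n)"
  have nz: "orth_poly a b (Suc n) \<noteq> 0" using ge2.IH(2) by auto
  have dP: "degree ?P = Suc (Suc n)" using nz ge2.IH(2) by (subst degree_mult_eq) auto
  have dQ: "degree (smult ((a (Suc n))\<^sup>2) (orth_poly a b n)) \<le> n"
    using ge2.IH(1) degree_smult_le[of "(a (Suc n))\<^sup>2" "orth_poly a b n"] by simp
  have e: "orth_poly a b (Suc (Suc n)) = ?P - smult ((a (Suc n))\<^sup>2) (orth_poly a b n)"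
    by (rule orth_poly.simps(3))
  have "coeff ?P (Suc (Suc n)) = 1"
    using lead_coeff_mult[of "[:- b (Suc (Suc n)), 1:]" "orth_poly a b (Suc n)"] dP ge2.IH(2) by simp
  moreover have "coeff (smult ((a (Suc n))\<^sup>2) (orth_poly a b n)) (Suc (Suc n)) = 0"
    by (rule coeff_eq_0, rule le_less_trans[OF dQ]) simp
  ultimately have c: "coeff (orth_poly a b (Suc (Suc n))) (Suc (Suc n)) = 1"
    unfolding e coeff_diff by simp
  moreover have "degree (orth_poly a b (Suc (Suc n))) \<le> Suc (Suc n)"
    unfolding e by (rule degree_diff_le) (use dP dQ in auto)
  moreover have "degree (orth_poly a b (Suc (Suc n))) \<ge> Suc (Suc n)"
    by (rule le_degree) (use c in auto)
  ultimately show ?case by linarith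
qed auto

lemma degree_orth_poly [simp]: "degree (orth_poly a b n) = n"
  and coeff_orth_poly [simp]: "coeff (orth_poly a b n) n = 1"
  using orth_poly_monic by auto

text \<open>Confluent Christoffel--Darboux: by the recurrence the Wronskian \<open>W\<^sub>n\<close> of \<open>\<pi>\<^sub>n\<^sub>+\<^sub>1\<close> and \<open>\<pi>\<^sub>n\<close> satisfies
  \<open>W\<^sub>n = \<pi>\<^sub>n\<^sup>2 + a\<^sub>n\<^sup>2 W\<^sub>n\<^sub>-\<^sub>1\<close> and \<open>W\<^sub>0 = 1\<close>.\<close>
lemma orth_poly_wronskian_pos:
  assumes "\<And>i. i \<ge> 1 \<Longrightarrow> a i > 0"
  shows "poly (pderiv (orth_poly a b (Suc n))) x * poly (orth_poly a b n) x
           - poly (orth_poly a b (Suc n)) x * poly (pderiv (orth_poly a b n)) x > 0"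
proof (induction n)
  case 0
  show ?case by (simp add: pderiv_pCons)
next
  case (Suc n)
  let ?W = "\<lambda>n. poly (pderiv (orth_poly a b (Suc n))) x * poly (orth_poly a b n) x
           - poly (orth_poly a b (Suc n)) x * poly (pderiv (orth_poly a b n)) x"
  have "?W (Suc n) = (poly (orth_poly a b (Suc n)) x)\<^sup>2 + (a (Suc n))\<^sup>2 * ?W n"
    by (simp add: pderiv_diff pderiv_mult pderiv_smult pderiv_pCons pderiv_add algebra_simps power2_eq_square)
  moreover have "(a (Suc n))\<^sup>2 * ?W n > 0" using Suc assms[of "Suc n"] by simp
  ultimately show ?case by (metis add_nonneg_pos zero_le_power2)
qed

text \<open>The polynomial \<open>z\<^sup>n \<pi>\<^sub>n(z + 1/z)\<close>, given by its own recurrence so that its degree and its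
  constant term can be computed without division by \<open>z\<close>.\<close>
fun lift_poly :: "(nat \<Rightarrow> real) \<Rightarrow> (nat \<Rightarrow> real) \<Rightarrow> nat \<Rightarrow> real poly" where
  "lift_poly a b 0 = 1"
| "lift_poly a b (Suc 0) = [:1, - b 1, 1:]"
| "lift_poly a b (Suc (Suc n)) =
     [:1, - b (Suc (Suc n)), 1:] * lift_poly a b (Suc n)
       - smult ((a (Suc n))\<^sup>2) ([:0, 0, 1:] * lift_poly a b n)"

lemma poly_lift_poly:
  "z \<noteq> 0 \<Longrightarrow> poly (cpoly (lift_poly a b n)) z = z ^ n * poly (cpoly (orth_poly a b n)) (z + inverse z)"
proof (induction n rule: induct_nat_012)
  case 1 then show ?case by (simp add: cpoly_hom field_simps power2_eq_square)
next
  case (ge2 n)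
  then show ?case by (simp add: cpoly_hom field_simps power2_eq_square del: mult_pCons_left mult_pCons_right)
qed auto

lemma lift_poly_monic: "degree (lift_poly a b n) = 2 * n \<and> coeff (lift_poly a b n) (2 * n) = 1"
proof (induction n rule: induct_nat_012)
  case (ge2 n)
  let ?P = "[:1, - b (Suc (Suc n)), 1:] * lift_poly a b (Suc n)"
  have nz: "lift_poly a b (Suc n) \<noteq> 0" using ge2.IH(2) by auto
  have dP: "degree ?P = 2 * Suc (Suc n)" using nz ge2.IH(2) by (subst degree_mult_eq) auto
  have "degree ([:0, 0, 1:] * lift_poly a b n) \<le> 2 * n + 2"
    using degree_mult_le[of "[:0, 0, 1::real:]" "lift_poly a b n"] ge2.IH(1) by simp
  then have dQ: "degree (smult ((a (Suc n))\<^sup>2) ([:0, 0, 1:] * lift_poly a b n)) \<le> 2 * n + 2"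
    using degree_smult_le order_trans by blast
  have lP: "coeff ?P (2 * Suc (Suc n)) = 1"
    using lead_coeff_mult[of "[:1, - b (Suc (Suc n)), 1:]" "lift_poly a b (Suc n)"] dP ge2.IH(2) by simp
  have lQ: "coeff (smult ((a (Suc n))\<^sup>2) ([:0, 0, 1:] * lift_poly a b n)) (2 * Suc (Suc n)) = 0"
    by (rule coeff_eq_0, rule le_less_trans[OF dQ]) simp
  have e: "lift_poly a b (Suc (Suc n)) = ?P - smult ((a (Suc n))\<^sup>2) ([:0, 0, 1:] * lift_poly a b n)"
    by (rule lift_poly.simps(3))
  have c: "coeff (lift_poly a b (Suc (Suc n))) (2 * Suc (Suc n)) = 1"
    unfolding e coeff_diff lP lQ by simp
  moreover have "degree (lift_poly a b (Suc (Suc n))) \<le> 2 * Suc (Suc n)"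
    unfolding e by (rule degree_diff_le) (use dP dQ in auto)
  moreover have "degree (lift_poly a b (Suc (Suc n))) \<ge> 2 * Suc (Suc n)"
    by (rule le_degree) (use c in auto)
  ultimately show ?case by linarith
qed (auto simp: numeral_2_eq_2)

lemma degree_lift_poly [simp]: "degree (lift_poly a b n) = 2 * n"
  and coeff_lift_poly [simp]: "coeff (lift_poly a b n) (2 * n) = 1"
  using lift_poly_monic by auto

lemma lift_poly_0 [simp]: "poly (lift_poly a b n) 0 = 1"
  by (induction n rule: induct_nat_012) auto

text \<open>The Jost function normalized to have value 1 at the origin, that is
  \<open>z\<^sup>p (\<pi>\<^sub>p(w) - a\<^sub>p\<^sup>2 z \<pi>\<^sub>p\<^sub>-\<^sub>1(w))\<close> with \<open>w = z + 1/z\<close>.\<close>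
definition jost_poly :: "(nat \<Rightarrow> real) \<Rightarrow> (nat \<Rightarrow> real) \<Rightarrow> nat \<Rightarrow> real poly" where
  "jost_poly a b p = lift_poly a b p - smult ((a p)\<^sup>2) ([:0, 0, 1:] * lift_poly a b (p - 1))"

lemma jost_poly_0 [simp]: "poly (jost_poly a b p) 0 = 1"
  by (simp add: jost_poly_def)

lemma poly_jost_poly:
  assumes "z \<noteq> 0" "p \<ge> 1"
  shows "poly (cpoly (jost_poly a b p)) z =
    z ^ p * (poly (cpoly (orth_poly a b p)) (z + inverse z)
      - z * (of_real ((a p)\<^sup>2) * poly (cpoly (orth_poly a b (p - 1))) (z + inverse z)))"
proof -
  obtain n where "p = Suc n" using assms(2) by (cases p) auto
  then show ?thesis using assms(1)
    by (simp add: jost_poly_def cpoly_hom poly_lift_poly algebra_simps power2_eq_square)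
qed

text \<open>One step of the recurrence isolates the two leading contributions, with coefficients \<open>1 - a\<^sub>p\<^sup>2\<close>
  and \<open>- b\<^sub>p\<close>; the three lemmas about the degree follow from it.\<close>
lemma jost_poly_recurse:
  assumes "p \<ge> 1"
  shows "\<exists>h. degree h \<le> 2 * p - 2 \<and> jost_poly a b p =
    h + smult (1 - (a p)\<^sup>2) ([:0, 0, 1:] * lift_poly a b (p - 1)) - smult (b p) ([:0, 1:] * lift_poly a b (p - 1))"
proof -
  obtain n where n: "p = Suc n" using assms(1) by (cases p) auto
  show ?thesis
  proof (cases n)
    case 0
    then show ?thesis using n by (intro exI[of _ 1]) (simp add: jost_poly_def one_pCons)
  next
    case (Suc m)
    let ?h = "lift_poly a b n - smult ((a n)\<^sup>2) ([:0, 0, 1:] * lift_poly a b m)"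
    have "degree (smult ((a n)\<^sup>2) ([:0, 0, 1:] * lift_poly a b m)) \<le> 2 * m + 2"
      using degree_mult_le[of "[:0, 0, 1::real:]" "lift_poly a b m"]
        degree_smult_le[of "(a n)\<^sup>2" "[:0, 0, 1:] * lift_poly a b m"] by simp
    then have "degree ?h \<le> 2 * p - 2" using n Suc by (intro degree_diff_le) auto
    moreover have "jost_poly a b p =
      ?h + smult (1 - (a p)\<^sup>2) ([:0, 0, 1:] * lift_poly a b (p - 1)) - smult (b p) ([:0, 1:] * lift_poly a b (p - 1))"
      by (rule poly_eqI) (simp add: jost_poly_def n Suc algebra_simps coeff_pCons split: nat.splits)
    ultimately show ?thesis by blast
  qed
qed

lemma degree_jost_poly_even:
  assumes "p \<ge> 1" "a p > 0" "a p \<noteq> 1"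
  shows "degree (jost_poly a b p) = 2 * p"
proof -
  obtain n where n: "p = Suc n" using assms(1) by (cases p) auto
  have 1: "(a p)\<^sup>2 \<noteq> 1" using assms by (simp add: power2_eq_1_iff)
  obtain h where h: "degree h \<le> 2 * p - 2" "jost_poly a b p =
    h + smult (1 - (a p)\<^sup>2) ([:0, 0, 1:] * lift_poly a b (p - 1)) - smult (b p) ([:0, 1:] * lift_poly a b (p - 1))"
    using jost_poly_recurse[OF assms(1)] by blast
  have z: "coeff h (2 * p) = 0" using h(1) n by (intro coeff_eq_0) auto
  have z2: "coeff (lift_poly a b n) (Suc (2 * n)) = 0" by (intro coeff_eq_0) auto
  have "coeff (jost_poly a b p) (2 * p) = 1 - (a p)\<^sup>2"
    unfolding h(2) using z z2 by (simp add: n)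
  then have ge: "degree (jost_poly a b p) \<ge> 2 * p" using 1 by (intro le_degree) auto
  have "degree ([:0, 0, 1:] * lift_poly a b (p - 1)) \<le> 2 * p"
    using degree_mult_le[of "[:0, 0, 1::real:]" "lift_poly a b (p - 1)"] n by simp
  then have "degree (jost_poly a b p) \<le> 2 * p" unfolding jost_poly_def
    by (intro degree_diff_le order_trans[OF degree_smult_le]) auto
  with ge show ?thesis by simp
qed

lemma degree_jost_poly_odd:
  assumes "p \<ge> 1" "a p = 1" "b p \<noteq> 0"
  shows "degree (jost_poly a b p) = 2 * p - 1"
proof -
  obtain n where n: "p = Suc n" using assms(1) by (cases p) auto
  obtain h where h: "degree h \<le> 2 * p - 2" "jost_poly a b p =
    h - smult (b p) ([:0, 1:] * lift_poly a b (p - 1))"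
    using jost_poly_recurse[OF assms(1), of a b] assms(2) by auto
  have z: "coeff h (2 * p - 1) = 0" using h(1) n by (intro coeff_eq_0) auto
  have "coeff (jost_poly a b p) (2 * p - 1) = - b p"
    unfolding h(2) using z by (simp add: n)
  then have ge: "degree (jost_poly a b p) \<ge> 2 * p - 1" using assms(3) by (intro le_degree) auto
  have "degree ([:0, 1:] * lift_poly a b (p - 1)) \<le> 2 * p - 1"
    using degree_mult_le[of "[:0, 1::real:]" "lift_poly a b (p - 1)"] n by simp
  then have "degree (jost_poly a b p) \<le> 2 * p - 1" unfolding h(2)
    using h(1) by (intro degree_diff_le order_trans[OF degree_smult_le]) auto
  with ge show ?thesis by simp
qed

lemma degree_jost_poly_trivial:
  assumes "p \<ge> 1" "a p = 1" "b p = 0"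
  shows "degree (jost_poly a b p) \<le> 2 * p - 2"
  using jost_poly_recurse[OF assms(1), of a b] assms(2,3) by auto

text \<open>The Wronskian of the Jost solution and the regular solution does not depend on the site.  At site 0
  it is \<open>\<psi>\<^sub>0\<close>, at site \<open>p\<close> the Jost solution is explicit because \<open>a\<^sub>p \<psi>\<^sub>p = z\<^sup>p\<close>.\<close>
lemma jost_function_eq_jost_poly:
  assumes a0: "a 0 = 1" and apos: "\<And>x. x \<ge> 1 \<Longrightarrow> a x > 0"
    and tail: "\<And>x. x > p \<Longrightarrow> a x = 1" "\<And>x. x > p \<Longrightarrow> b x = 0"
    and p: "p \<ge> 1"
  shows "jost_function a b p = smult (of_real (inverse (\<Prod>i=1..p. a i))) (cpoly (jost_poly a b p))"
proof -
  let ?J = "jost_function a b p" and ?c = "complex_of_real (\<Prod>i=1..p. a i)"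
  have "(\<Prod>i=1..p. a i) > 0" using apos by (intro prod_pos) auto
  then have c0: "?c \<noteq> 0" by (simp only: of_real_eq_0_iff)
  have "poly (smult ?c ?J) z = poly (cpoly (jost_poly a b p)) z" if z: "z \<noteq> 0" for z
  proof -
    obtain \<psi> where \<psi>: "jost_solution a b p z \<psi>" "poly ?J z = \<psi> 0"
      using jost_function_eq[of a p b z] a0 apos tail z by blast
    have rec: "of_real (a (Suc x)) * \<psi> (Suc (Suc x)) + of_real (b (Suc x)) * \<psi> (Suc x) + of_real (a x) * \<psi> x
       = (z + inverse z) * \<psi> (Suc x)" for x
      using \<psi>(1) by (auto simp: jost_solution_def jacobi_expr_def dest: spec[of _ "Suc x"])
    have free: "\<psi> x = z ^ x" if "x > p" for x using \<psi>(1) that by (auto simp: jost_solution_def)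
    let ?\<pi> = "\<lambda>n. poly (cpoly (orth_poly a b n)) (z + inverse z)"
    \<comment> \<open>The Wronskian, multiplied by the product of the \<open>a\<^sub>i\<close>, which turns orthonormal into monic polynomials.\<close>
    have wr: "of_real (\<Prod>i=1..Suc n. a i) * \<psi> 0 =
      of_real (a (Suc n)) * (\<psi> (Suc n) * ?\<pi> (Suc n) - of_real (a (Suc n)) * \<psi> (Suc (Suc n)) * ?\<pi> n)" for n
    proof (induction n)
      case 0
      have e: "\<psi> 0 = (z + inverse z) * \<psi> (Suc 0) - of_real (b (Suc 0)) * \<psi> (Suc 0)
        - of_real (a (Suc 0)) * \<psi> (Suc (Suc 0))"
        using rec[of 0] a0 by (simp add: algebra_simps)
      show ?case by (subst e) (simp add: algebra_simps)
    next
      case (Suc n)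
      have r: "of_real (a (Suc (Suc n))) * \<psi> (Suc (Suc (Suc n))) =
        (z + inverse z) * \<psi> (Suc (Suc n)) - of_real (b (Suc (Suc n))) * \<psi> (Suc (Suc n)) - of_real (a (Suc n)) * \<psi> (Suc n)"
        using rec[of "Suc n"] by (simp add: algebra_simps)
      have "of_real (\<Prod>i=1..Suc (Suc n). a i) * \<psi> 0 = of_real (a (Suc (Suc n))) * (of_real (\<Prod>i=1..Suc n. a i) * \<psi> 0)"
        by (simp add: mult_ac)
      also have "\<dots> = of_real (a (Suc (Suc n))) * (of_real (a (Suc n)) * (\<psi> (Suc n) * ?\<pi> (Suc n) - of_real (a (Suc n)) * \<psi> (Suc (Suc n)) * ?\<pi> n))"
        by (simp only: Suc.IH)
      also have "\<dots> = of_real (a (Suc (Suc n))) * (\<psi> (Suc (Suc n)) * ?\<pi> (Suc (Suc n)) - of_real (a (Suc (Suc n))) * \<psi> (Suc (Suc (Suc n))) * ?\<pi> (Suc n))"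
        unfolding r by (simp add: cpoly_hom algebra_simps power2_eq_square)
      finally show ?case .
    qed
    obtain n where n: "p = Suc n" using p by (cases p) auto
    have f1: "\<psi> (Suc p) = z ^ Suc p" using free[of "Suc p"] by simp
    have f2: "\<psi> (Suc (Suc p)) = z ^ Suc (Suc p)" using free[of "Suc (Suc p)"] by simp
    have ap: "of_real (a p) * \<psi> p = z ^ p"
      using rec[of p] tail[of "Suc p"] z unfolding f1 f2 by (simp add: field_simps)
    have "?c * \<psi> 0 = (of_real (a p) * \<psi> p) * ?\<pi> p - of_real (a p) * of_real (a p) * \<psi> (Suc p) * ?\<pi> n"
      using wr[of n] by (simp add: n algebra_simps)
    also have "\<dots> = poly (cpoly (jost_poly a b p)) z"
      unfolding ap poly_jost_poly[OF z p] f1 by (simp add: n algebra_simps power2_eq_square)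
    finally show ?thesis using \<psi>(2) by simp
  qed
  then have "- {0} \<subseteq> {z. poly (smult ?c ?J - cpoly (jost_poly a b p)) z = 0}" by auto
  moreover have "infinite (- {0 :: complex})"
    by (simp add: Compl_eq_Diff_UNIV infinite_UNIV_char_0)
  ultimately have "smult ?c ?J - cpoly (jost_poly a b p) = 0"
    using finite_subset poly_roots_finite by blast
  then have "smult (inverse ?c) (smult ?c ?J) = smult (inverse ?c) (cpoly (jost_poly a b p))" by simp
  then show ?thesis using c0 by simp
qed

section \<open>The sign condition on the roots in the disc\<close>

text \<open>The characterization of Jost functions by their roots.  The inequality contains the requirements
  that roots in the open disc are simple and that their inverses are not roots.\<close>
definition admissible :: "real poly \<Rightarrow> bool" where
  "admissible f \<longleftrightarrow> poly f 0 \<noteq> 0 \<and>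
     (\<forall>z. norm z \<le> 1 \<longrightarrow> poly (cpoly f) z = 0 \<longrightarrow> z \<in> \<real>) \<and>
     (\<forall>s. \<bar>s\<bar> < 1 \<longrightarrow> poly f s = 0 \<longrightarrow> s * poly (pderiv f) s * poly f (inverse s) > 0) \<and>
     (\<forall>s. \<bar>s\<bar> = 1 \<longrightarrow> poly f s = 0 \<longrightarrow> poly (pderiv f) s \<noteq> 0)"

lemma poly_jost_poly_real:
  assumes "z \<noteq> 0" "p \<ge> 1"
  shows "poly (jost_poly a b p) z =
    z ^ p * (poly (orth_poly a b p) (z + inverse z)
      - z * ((a p)\<^sup>2 * poly (orth_poly a b (p - 1)) (z + inverse z)))"
proof -
  have "complex_of_real z + inverse (complex_of_real z) = complex_of_real (z + inverse z)" by simp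
  then have "complex_of_real (poly (jost_poly a b p) z) = complex_of_real (z ^ p * (poly (orth_poly a b p) (z + inverse z)
      - z * ((a p)\<^sup>2 * poly (orth_poly a b (p - 1)) (z + inverse z))))"
    using poly_jost_poly[of "complex_of_real z" p a b] assms
    by (simp del: of_real_add of_real_inverse)
  then show ?thesis by (simp only: of_real_eq_iff)
qed

text \<open>At a root the factor \<open>z\<^sup>p\<close> contributes nothing to the derivative, and \<open>dw/dz = 1 - 1/z\<^sup>2\<close>.\<close>
lemma poly_pderiv_jost_poly:
  fixes a b :: "nat \<Rightarrow> real" and p :: nat and z :: real
  assumes "z \<noteq> 0" "p \<ge> 1" "poly (jost_poly a b p) z = 0"
  defines "A \<equiv> orth_poly a b p" and "B \<equiv> smult ((a p)\<^sup>2) (orth_poly a b (p - 1))" and "w \<equiv> z + inverse z"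
  shows "poly A w = z * poly B w"
    and "poly (pderiv (jost_poly a b p)) z =
      z ^ p * ((poly (pderiv A) w - z * poly (pderiv B) w) * (1 - inverse (z\<^sup>2)) - poly B w)"
proof -
  let ?G = "\<lambda>z. z ^ p * (poly A (z + inverse z) - z * poly B (z + inverse z))"
  have eq: "?G x = poly (jost_poly a b p) x" if "x \<noteq> 0" for x
    using poly_jost_poly_real[OF that assms(2), of a b] by (simp add: A_def B_def)
  show 1: "poly A w = z * poly B w"
    using eq[OF assms(1)] assms(1,3) by (simp add: w_def)
  have "(?G has_field_derivative (z ^ p * ((poly (pderiv A) w - z * poly (pderiv B) w) * (1 - inverse (z\<^sup>2)) - poly B w))) (at z)"
    using assms(1) 1 unfolding w_def
    by (auto intro!: derivative_eq_intros DERIV_chain2[OF poly_DERIV] simp: field_simps power2_eq_square)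
  then have "(poly (jost_poly a b p) has_field_derivative (z ^ p * ((poly (pderiv A) w - z * poly (pderiv B) w) * (1 - inverse (z\<^sup>2)) - poly B w))) (at z)"
    by (rule has_field_derivative_transform_within_open[of _ _ _ "- {0}"]) (use assms(1) eq in auto)
  then show "poly (pderiv (jost_poly a b p)) z =
      z ^ p * ((poly (pderiv A) w - z * poly (pderiv B) w) * (1 - inverse (z\<^sup>2)) - poly B w)"
    using poly_DERIV DERIV_unique by blast
qed

text \<open>At a root \<open>A(w) = z B(w)\<close>.  Inserting this gives
  \<open>s f'(s) f(1/s) = (1 - s\<^sup>2) (W (1/s\<^sup>2 - 1) + B\<^sup>2)\<close> with the positive Wronskian \<open>W\<close>.  On the unit circle
  \<open>w\<close> is real, so a non-real root would be a common zero of \<open>A\<close> and \<open>B\<close>, and a double root at \<open>\<plusminus>1\<close>, where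
  \<open>dw/dz = 0\<close>, would be one as well; but then \<open>W = 0\<close>.\<close>
lemma jost_poly_admissible:
  assumes apos: "\<And>i. i \<ge> 1 \<Longrightarrow> a i > 0" and p: "p \<ge> 1"
    and disc: "\<And>z. norm z < 1 \<Longrightarrow> poly (cpoly (jost_poly a b p)) z = 0 \<Longrightarrow> z \<in> \<real>"
  shows "admissible (jost_poly a b p)"
proof -
  let ?g = "jost_poly a b p"
  define A where "A = orth_poly a b p"
  define B where "B = smult ((a p)\<^sup>2) (orth_poly a b (p - 1))"
  define W where "W x = poly (pderiv A) x * poly B x - poly A x * poly (pderiv B) x" for x
  obtain n where n: "p = Suc n" using p by (cases p) auto
  have W: "W x > 0" for x
  proof -
    have "W x = (a p)\<^sup>2 * (poly (pderiv (orth_poly a b (Suc n))) x * poly (orth_poly a b n) x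
           - poly (orth_poly a b (Suc n)) x * poly (pderiv (orth_poly a b n)) x)"
      by (simp add: W_def A_def B_def n pderiv_smult algebra_simps del: orth_poly.simps)
    then show ?thesis using orth_poly_wronskian_pos[OF apos] apos[OF p] by simp
  qed
  have unit: "z \<in> \<real>" if z: "norm z = 1" "poly (cpoly ?g) z = 0" for z
  proof (rule ccontr)
    assume nr: "z \<notin> \<real>"
    have z0: "z \<noteq> 0" using z by auto
    have "inverse z = cnj z" using z(1) by (metis complex_div_cnj inverse_eq_divide mult_1 of_real_1 power_one div_by_1)
    then have "z + inverse z = of_real (2 * Re z)" by (simp add: complex_add_cnj)
    then obtain x where x: "z + inverse z = of_real x" by blast
    have "z ^ p * (of_real (poly A x) - z * of_real (poly B x)) = 0"
      using poly_jost_poly[OF z0 p, of a b] z(2) unfolding x poly_cpoly_of_real A_def B_def by simp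
    then have e: "of_real (poly A x) = z * of_real (poly B x)" using z0 by simp
    have "poly B x = 0"
    proof (rule ccontr)
      assume "poly B x \<noteq> 0"
      then have "z = of_real (poly A x / poly B x)" using e by (simp add: field_simps)
      then show False using nr by (metis Reals_of_real)
    qed
    moreover from this have "poly A x = 0" using e by simp
    ultimately show False using W[of x] by (simp add: W_def)
  qed
  have sgn: "s * poly (pderiv ?g) s * poly ?g (inverse s) > 0" if s: "\<bar>s\<bar> < 1" "poly ?g s = 0" for s
  proof -
    have s0: "s \<noteq> 0" using s(2) by auto
    let ?w = "s + inverse s"
    note d = poly_pderiv_jost_poly[OF s0 p s(2), folded A_def B_def]
    have i: "poly ?g (inverse s) = inverse s ^ p * (poly A ?w - inverse s * poly B ?w)"
      using poly_jost_poly_real[of "inverse s" p a b] s0 p by (simp add: A_def B_def add.commute)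
    have "s * poly (pderiv ?g) s * poly ?g (inverse s) =
      (s ^ p * inverse s ^ p) * (s * ((poly (pderiv A) ?w - s * poly (pderiv B) ?w) * (1 - inverse (s\<^sup>2)) - poly B ?w) * (poly A ?w - inverse s * poly B ?w))"
      unfolding d(2) i by (simp add: mult_ac)
    also have "\<dots> = s * ((poly (pderiv A) ?w - s * poly (pderiv B) ?w) * (1 - inverse (s\<^sup>2)) - poly B ?w) * (poly A ?w - inverse s * poly B ?w)"
      using s0 by (simp add: power_mult_distrib[symmetric])
    also have "\<dots> = (1 - s\<^sup>2) * ((poly (pderiv A) ?w * poly B ?w - (s * poly B ?w) * poly (pderiv B) ?w) * (inverse (s\<^sup>2) - 1) + (poly B ?w)\<^sup>2)"
      unfolding d(1) using s0 by (simp add: field_simps power2_eq_square)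
    also have "\<dots> = (1 - s\<^sup>2) * (W ?w * (inverse (s\<^sup>2) - 1) + (poly B ?w)\<^sup>2)"
      unfolding W_def d(1) ..
    also have "\<dots> > 0"
    proof -
      have "s\<^sup>2 < 1" "s\<^sup>2 > 0" using s(1) s0 by (auto simp: abs_square_less_1)
      then have "inverse (s\<^sup>2) - 1 > 0" using one_less_inverse[of "s\<^sup>2"] by simp
      then show ?thesis using \<open>s\<^sup>2 < 1\<close> W[of ?w] by (simp add: add_pos_nonneg)
    qed
    finally show ?thesis .
  qed
  have "poly (pderiv ?g) s \<noteq> 0" if s: "\<bar>s\<bar> = 1" "poly ?g s = 0" for s
  proof
    assume "poly (pderiv ?g) s = 0"
    moreover have s0: "s \<noteq> 0" and s2: "s\<^sup>2 = 1" using s(1) by (auto simp: abs_if power2_eq_square split: if_splits)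
    note d = poly_pderiv_jost_poly[OF s0 p s(2), folded A_def B_def]
    ultimately have "poly B (s + inverse s) = 0" using d(2) s0 s2 by simp
    moreover from this have "poly A (s + inverse s) = 0" using d(1) by simp
    ultimately show False using W[of "s + inverse s"] by (simp add: W_def)
  qed
  then show ?thesis unfolding admissible_def using disc unit sgn
    by (metis jost_poly_0 order_le_less zero_neq_one)
qed

text \<open>A factor \<open>c\<close> changes \<open>s g'(s) g(1/s)\<close> by \<open>c(s) c(1/s)\<close>.  A weak inequality for this number is enough
  here, because the product is known to be nonzero; in particular \<open>c\<close> and \<open>g\<close> then share no root in the
  disc.\<close>
lemma admissible_cofactor:
  assumes adm: "admissible (c * g)"
    and sgn: "\<And>s. \<bar>s\<bar> < 1 \<Longrightarrow> poly g s = 0 \<Longrightarrow> poly c s * poly c (inverse s) \<ge> 0"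
  shows "admissible g"
proof -
  have der: "poly (pderiv (c * g)) s = poly c s * poly (pderiv g) s" if "poly g s = 0" for s
    using that by (simp add: pderiv_mult)
  have "s * poly (pderiv g) s * poly g (inverse s) > 0" if s: "\<bar>s\<bar> < 1" "poly g s = 0" for s
  proof -
    have "s * poly (pderiv (c * g)) s * poly (c * g) (inverse s) > 0"
      using adm s unfolding admissible_def by simp
    then have "(s * poly (pderiv g) s * poly g (inverse s)) * (poly c s * poly c (inverse s)) > 0"
      unfolding der[OF s(2)] by (simp add: mult_ac)
    then show ?thesis using sgn[OF s] by (auto simp: zero_less_mult_iff)
  qed
  then show ?thesis using adm unfolding admissible_def
    by (auto simp: cpoly_hom) (metis der mult_zero_right)
qed

lemma admissible_mult:
  assumes adm: "admissible g"
    and nz: "\<And>z. norm z \<le> 1 \<Longrightarrow> poly (cpoly c) z \<noteq> 0"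
    and sgn: "\<And>s. \<bar>s\<bar> < 1 \<Longrightarrow> poly g s = 0 \<Longrightarrow> poly c s * poly c (inverse s) > 0"
  shows "admissible (c * g)"
proof -
  have der: "poly (pderiv (c * g)) s = poly c s * poly (pderiv g) s" if "poly g s = 0" for s
    using that by (simp add: pderiv_mult)
  have nzr: "poly c s \<noteq> 0" if "\<bar>s\<bar> \<le> 1" for s
    using nz[of "of_real s"] that by simp
  have "s * poly (pderiv (c * g)) s * poly (c * g) (inverse s) > 0" if s: "\<bar>s\<bar> < 1" "poly (c * g) s = 0" for s
  proof -
    have g: "poly g s = 0" using s nzr[of s] by simp
    have "(s * poly (pderiv g) s * poly g (inverse s)) * (poly c s * poly c (inverse s)) > 0"
      using adm s g sgn[OF s(1) g] unfolding admissible_def by simp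
    then show ?thesis unfolding der[OF g] by (simp add: mult_ac)
  qed
  moreover have "poly (pderiv (c * g)) s \<noteq> 0" if s: "\<bar>s\<bar> = 1" "poly (c * g) s = 0" for s
    using adm s nzr[of s] der[of s] unfolding admissible_def by simp
  ultimately show ?thesis using adm nz nzr[of 0] unfolding admissible_def
    by (auto simp: cpoly_hom)
qed

section \<open>The decomposition of a polynomial with respect to z + 1/z\<close>

text \<open>Induction on \<open>p\<close>: for degree \<open>2p + 2\<close>, subtracting multiples of \<open>(1 + z\<^sup>2)\<^sup>p\<^sup>+\<^sup>1 = z\<^sup>p\<^sup>+\<^sup>1 w\<^sup>p\<^sup>+\<^sup>1\<close> and of
  \<open>z\<^sup>2 (1 + z\<^sup>2)\<^sup>p = z\<^sup>p\<^sup>+\<^sup>1 z w\<^sup>p\<close> removes the constant and the top coefficient, and what remains is \<open>z\<close> times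
  a polynomial of degree at most \<open>2p\<close>.\<close>
lemma joukowski_decomposition:
  assumes "degree f \<le> 2 * p"
  shows "\<exists>A B. degree A \<le> p \<and> (\<forall>i\<ge>p. coeff B i = 0) \<and>
    (\<forall>z. z \<noteq> 0 \<longrightarrow> poly (cpoly f) z =
       z ^ p * (poly (cpoly A) (z + inverse z) - z * poly (cpoly B) (z + inverse z)))"
  using assms
proof (induction p arbitrary: f)
  case 0
  then obtain c where "f = [:c:]" by (auto elim: degree_eq_zeroE)
  then show ?case by (intro exI[of _ f] exI[of _ 0]) auto
next
  case (Suc p)
  let ?u = "[:1, 0, 1:] :: real poly"
  have du: "degree (?u ^ n) = 2 * n" "coeff (?u ^ n) (2 * n) = 1" "coeff (?u ^ n) 0 = 1" for n
  proof -
    show d: "degree (?u ^ n) = 2 * n" by (simp add: degree_power_eq)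
    show "coeff (?u ^ n) (2 * n) = 1" using lead_coeff_power[of ?u n] unfolding d by simp
    show "coeff (?u ^ n) 0 = 1" by (simp add: coeff_0_power)
  qed
  define \<alpha> where "\<alpha> = coeff f 0"
  define \<gamma> where "\<gamma> = coeff f (2 * Suc p) - \<alpha>"
  define f' where "f' = f - smult \<alpha> (?u ^ Suc p) - smult \<gamma> ([:0, 0, 1:] * ?u ^ p)"
  obtain h where h: "f' = pCons 0 h"
  proof -
    have "coeff f' 0 = 0" unfolding f'_def coeff_diff coeff_smult du(3) by (simp add: \<alpha>_def)
    then show ?thesis using that by (cases f') auto
  qed
  have dh: "degree h \<le> 2 * p"
  proof (rule degree_le, intro allI impI)
    fix i assume i: "2 * p < i"
    have "coeff f' (Suc i) = 0"
    proof (cases "Suc i = 2 * Suc p")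
      case True
      then have "coeff f' (Suc i) = coeff f (2 * Suc p) - \<alpha> * coeff (?u ^ Suc p) (2 * Suc p) - \<gamma> * coeff (?u ^ p) (2 * p)"
        by (simp add: f'_def)
      then show ?thesis unfolding du(2) by (simp add: \<gamma>_def)
    next
      case False
      then have i2: "Suc i > 2 * Suc p" using i by simp
      have "coeff f (Suc i) = 0" using i2 Suc.prems by (intro coeff_eq_0) simp
      moreover have "coeff (?u ^ Suc p) (Suc i) = 0" by (rule coeff_eq_0) (use i2 du(1)[of "Suc p"] in linarith)
      moreover have "coeff ([:0, 0, 1:] * ?u ^ p) (Suc i) = 0"
      proof -
        have "coeff (?u ^ p) (i - 1) = 0" by (rule coeff_eq_0, unfold du(1)) (use i2 in simp)
        moreover obtain i' where "i = Suc i'" using i by (cases i) auto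
        ultimately show ?thesis by simp
      qed
      ultimately show ?thesis unfolding f'_def coeff_diff coeff_smult by simp
    qed
    then show "coeff h i = 0" by (simp add: h)
  qed
  then obtain A B where AB: "degree A \<le> p" "\<forall>i\<ge>p. coeff B i = 0"
    "\<And>z. z \<noteq> 0 \<Longrightarrow> poly (cpoly h) z = z ^ p * (poly (cpoly A) (z + inverse z) - z * poly (cpoly B) (z + inverse z))"
    using Suc.IH by blast
  let ?A = "monom \<alpha> (Suc p) + A" and ?B = "B - monom \<gamma> p"
  have "degree ?A \<le> Suc p" using AB(1) by (intro degree_add_le) (auto intro: degree_monom_le)
  moreover have "\<forall>i\<ge>Suc p. coeff ?B i = 0" using AB(2) by auto
  moreover have "poly (cpoly f) z = z ^ Suc p * (poly (cpoly ?A) (z + inverse z) - z * poly (cpoly ?B) (z + inverse z))"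
    if z: "z \<noteq> 0" for z
  proof -
    have pu: "poly (cpoly (?u ^ n)) z = z ^ n * (z + inverse z) ^ n" for n
    proof -
      have "poly (cpoly (?u ^ n)) z = (1 + z\<^sup>2) ^ n"
        by (induction n) (auto simp: cpoly_hom power2_eq_square algebra_simps)
      also have "1 + z\<^sup>2 = z * (z + inverse z)" using z by (simp add: power2_eq_square algebra_simps)
      finally show ?thesis by (simp add: power_mult_distrib)
    qed
    have "f = smult \<alpha> (?u ^ Suc p) + smult \<gamma> ([:0, 0, 1:] * ?u ^ p) + [:0, 1:] * h"
      using h f'_def by (simp add: algebra_simps)
    then have "poly (cpoly f) z = of_real \<alpha> * poly (cpoly (?u ^ Suc p)) z + of_real \<gamma> * (z\<^sup>2 * poly (cpoly (?u ^ p)) z) + z * poly (cpoly h) z"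
      by (simp add: cpoly_hom power2_eq_square del: power_Suc)
    also have "\<dots> = z ^ Suc p * (poly (cpoly ?A) (z + inverse z) - z * poly (cpoly ?B) (z + inverse z))"
      unfolding pu AB(3)[OF z] by (simp add: cpoly_hom map_poly_monom poly_monom algebra_simps power2_eq_square)
    finally show ?thesis .
  qed
  ultimately show ?case by blast
qed

text \<open>Turns \<open>q(z + 1/z)\<close> into a polynomial in \<open>z\<close>, so that the integrands below become rational functions
  without a pole of high order at 0.\<close>
lemma palindromic_lift:
  assumes "degree q \<le> m"
  shows "\<exists>Q. coeff Q 0 = coeff q m \<and>
    (\<forall>z. z \<noteq> 0 \<longrightarrow> poly (cpoly Q) z = z ^ m * poly (cpoly q) (z + inverse z))"
  using assms
proof (induction m arbitrary: q)
  case 0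
  then show ?case by (intro exI[of _ q]) (auto elim!: degree_eq_zeroE)
next
  case (Suc m)
  obtain c q' where q: "q = pCons c q'" by (cases q)
  have "degree q' \<le> m" using Suc.prems q by (cases "q' = 0") auto
  then obtain Q where Q: "coeff Q 0 = coeff q' m"
    "\<And>z. z \<noteq> 0 \<Longrightarrow> poly (cpoly Q) z = z ^ m * poly (cpoly q') (z + inverse z)"
    using Suc.IH by blast
  show ?case
    by (intro exI[of _ "monom c (Suc m) + [:1, 0, 1:] * Q"])
      (simp add: q Q cpoly_hom map_poly_monom poly_monom field_simps power2_eq_square)
qed

lemma joukowski_surj: "\<exists>z::complex. z \<noteq> 0 \<and> z + inverse z = w"
proof -
  define z where "z = (w + csqrt (w\<^sup>2 - 4)) / 2"
  have e: "z * (w - z) = 1"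
    using power2_csqrt[of "w\<^sup>2 - 4"] by (simp add: z_def field_simps power2_eq_square)
  then have "z \<noteq> 0" by auto
  moreover have "inverse z = w - z" using e by (metis inverse_unique)
  ultimately show ?thesis by (intro exI[of _ z]) simp
qed

text \<open>The points \<open>z\<close> and \<open>1/z\<close> have the same \<open>w\<close>, so the two values of the decomposition there
  determine \<open>A(w)\<close> and \<open>B(w)\<close> unless \<open>z\<^sup>2 = 1\<close>.\<close>
lemma joukowski_decomposition_unique:
  fixes A A' B B' :: "complex poly"
  assumes "\<And>z. z \<noteq> 0 \<Longrightarrow> poly A (z + inverse z) - z * poly B (z + inverse z)
     = poly A' (z + inverse z) - z * poly B' (z + inverse z)"
  shows "A = A'" "B = B'"
proof -
  have e: "poly (A - A') (z + inverse z) = z * poly (B - B') (z + inverse z)" if "z \<noteq> 0" for z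
    using assms[OF that] by (simp add: algebra_simps) 
  have "poly (B - B') w = 0" if w: "w \<noteq> 2" "w \<noteq> - 2" for w
  proof -
    obtain z where z: "z \<noteq> 0" "z + inverse z = w" using joukowski_surj by blast
    have "z\<^sup>2 \<noteq> 1" using w z(2) by (auto simp: power2_eq_1_iff)
    then have "z \<noteq> inverse z" using z(1) by (auto simp: power2_eq_square field_simps)
    moreover have "z * poly (B - B') w = inverse z * poly (B - B') w"
      using e[OF z(1)] e[of "inverse z"] z by (simp add: add.commute)
    ultimately show ?thesis by simp
  qed
  then have "- {2, - 2} \<subseteq> {w. poly (B - B') w = 0}" by auto
  moreover have "infinite (- {2, - 2 :: complex})"
    by (simp add: Compl_eq_Diff_UNIV infinite_UNIV_char_0)
  ultimately have B: "B - B' = 0" using finite_subset poly_roots_finite by blast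
  then show "B = B'" by simp
  have "poly (A - A') w = 0" for w
  proof -
    obtain z where z: "z \<noteq> 0" "z + inverse z = w" using joukowski_surj by blast
    then show ?thesis using e[OF z(1)] B by simp
  qed
  then have "A - A' = 0" using poly_all_0_iff_0 by blast
  then show "A = A'" by simp
qed

section \<open>Residues on the unit circle\<close>

definition circ :: "real \<Rightarrow> complex" where "circ t = cis (2 * pi * t)"

lemma norm_circ [simp]: "norm (circ t) = 1"
  by (simp add: circ_def)

lemma circ_nonzero [simp]: "circ t \<noteq> 0"
  by (simp add: circ_def)

lemma inverse_circ: "inverse (circ t) = cnj (circ t)"
  by (simp add: circ_def cis_cnj)

lemma circ_joukowski: "circ t + inverse (circ t) = of_real (2 * cos (2 * pi * t))"
  unfolding inverse_circ by (simp add: complex_add_cnj) (simp add: circ_def)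

lemma continuous_on_circ [continuous_intros]: "continuous_on S circ"
  unfolding circ_def by (intro continuous_intros)

text \<open>The residue theorem for \<open>N/h\<close>, applied in the whole plane: roots of \<open>h\<close> outside the disc have
  winding number 0, and where \<open>N\<close> cancels a simple root inside, the formula for the residue at a simple
  pole correctly yields 0.\<close>
lemma circle_integral_rational:
  fixes N h :: "complex poly"
  assumes circle: "\<And>z. norm z = 1 \<Longrightarrow> poly h z \<noteq> 0"
    and simple: "\<And>z. norm z < 1 \<Longrightarrow> poly h z = 0 \<Longrightarrow> poly (pderiv h) z \<noteq> 0"
  shows "((\<lambda>t. circ t * (poly N (circ t) / poly h (circ t))) has_integral
    (\<Sum>z | norm z < 1 \<and> poly h z = 0. poly N z / poly (pderiv h) z)) {0..1}"
proof -
  let ?f = "\<lambda>z. poly N z / poly h z"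
  let ?\<gamma> = "circlepath 0 1"
  define pts where "pts = {z. poly h z = 0}"
  define D where "D = {z. norm z < 1 \<and> poly h z = 0}"
  have "h \<noteq> 0" using circle[of 1] by auto
  then have fin: "finite pts" unfolding pts_def by (rule poly_roots_finite)
  have circ_eq: "?\<gamma> t = circ t" for t
    by (simp add: circlepath circ_def cis_conv_exp mult_ac)
  have img: "path_image ?\<gamma> \<subseteq> - pts"
    using circle by (auto simp: pts_def)
  have "continuous_on (path_image ?\<gamma>) ?f"
    using img by (intro continuous_intros) (auto simp: pts_def)
  then have intble: "?f contour_integrable_on ?\<gamma>"
    by (rule contour_integrable_continuous_circlepath)
  have wind: "winding_number ?\<gamma> z = (if norm z < 1 then 1 else 0)" if "z \<in> pts" for z
  proof (cases "norm z < 1")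
    case True
    then show ?thesis using winding_number_circlepath[of z 0 1] by simp
  next
    case False
    then have "norm z > 1" using circle that by (metis linorder_neqE_linordered_idom mem_Collect_eq pts_def)
    then have "winding_number ?\<gamma> z = 0"
      by (intro winding_number_zero_outside[of _ "cball 0 1"]) auto
    then show ?thesis using False by simp
  qed
  have res: "residue ?f z = poly N z / poly (pderiv h) z" if z: "norm z < 1" "poly h z = 0" for z
  proof (cases "poly N z = 0")
    case False
    show ?thesis
      by (rule residue_simple_pole_deriv[of _ UNIV])
        (use False z simple[OF z] in \<open>auto intro!: holomorphic_intros poly_DERIV\<close>)
  next
    case True
    then obtain N' where N': "N = [:- z, 1:] * N'" by (auto simp: poly_eq_0_iff_dvd)
    obtain h' where h': "h = [:- z, 1:] * h'" using z(2) by (auto simp: poly_eq_0_iff_dvd)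
    have "poly h' z \<noteq> 0" using simple[OF z] unfolding h' by (simp add: pderiv_mult pderiv_pCons pderiv_diff pderiv_smult)
    moreover have "open {w. poly h' w \<noteq> 0}"
    proof -
      have "open (poly h' -` (- {0}))" by (intro open_vimage) (auto intro: continuous_intros)
      moreover have "poly h' -` (- {0}) = {w. poly h' w \<noteq> 0}" by auto
      ultimately show ?thesis by simp
    qed
    ultimately have "residue (\<lambda>w. poly N' w / poly h' w) z = 0"
      by (intro residue_holo[of "{w. poly h' w \<noteq> 0}"]) (auto intro!: holomorphic_intros)
    moreover have "residue ?f z = residue (\<lambda>w. poly N' w / poly h' w) z"
    proof (rule residue_cong)
      show "eventually (\<lambda>w. ?f w = poly N' w / poly h' w) (at z)"
        unfolding N' h' poly_mult by (auto simp: eventually_at intro!: exI[of _ 1])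
    qed simp
    ultimately show ?thesis using True by simp
  qed
  have "contour_integral ?\<gamma> ?f = 2 * pi * \<i> * (\<Sum>z\<in>pts. winding_number ?\<gamma> z * residue ?f z)"
    by (rule Residue_theorem[of UNIV])
      (use fin img in \<open>auto intro!: holomorphic_intros simp: pts_def\<close>)
  also have "(\<Sum>z\<in>pts. winding_number ?\<gamma> z * residue ?f z) = (\<Sum>z\<in>D. poly N z / poly (pderiv h) z)"
    by (rule sum.mono_neutral_cong_right) (use fin wind res in \<open>auto simp: D_def pts_def\<close>)
  finally have "(?f has_contour_integral (2 * pi * \<i> * (\<Sum>z\<in>D. poly N z / poly (pderiv h) z))) ?\<gamma>"
    using has_contour_integral_integral[OF intble] by simp
  then have "((\<lambda>t. ?f (circ t) * (2 * pi * \<i> * circ t)) has_integral (2 * pi * \<i> * (\<Sum>z\<in>D. poly N z / poly (pderiv h) z))) {0..1}"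
    unfolding has_contour_integral circ_eq vector_derivative_circlepath
    by (simp add: circ_def cis_conv_exp mult_ac)
  then have "((\<lambda>t. inverse (2 * pi * \<i>) * (?f (circ t) * (2 * pi * \<i> * circ t))) has_integral
     inverse (2 * pi * \<i>) * (2 * pi * \<i> * (\<Sum>z\<in>D. poly N z / poly (pderiv h) z))) {0..1}"
    by (rule has_integral_mult_right)
  then show ?thesis unfolding D_def by (simp add: field_simps)
qed

text \<open>A Jost function may vanish at \<open>\<plusminus>1\<close>.  Such a zero is simple and cancels against \<open>1 - z\<^sup>2\<close>, so the
  quotient \<open>(1 - z\<^sup>2) / f = e / h\<close> is regular on the whole circle.  This and the next lemma provide \<open>e\<close> and
  \<open>h\<close>, removing one of the two points at a time.\<close>
lemma split_root_at_unit:
  fixes f :: "real poly"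
  assumes c: "c \<noteq> 0" and simple: "poly f c = 0 \<Longrightarrow> poly (pderiv f) c \<noteq> 0"
  shows "\<exists>d e h. d * e = [:c, -1:] \<and> f = d * h \<and> poly h c \<noteq> 0"
proof (cases "poly f c = 0")
  case False
  then show ?thesis by (intro exI[of _ 1] exI[of _ "[:c, -1:]"] exI[of _ f]) auto
next
  case True
  then obtain h where h: "f = [:- c, 1:] * h" by (auto simp: poly_eq_0_iff_dvd)
  then have f: "f = [:c, -1:] * (- h)" by simp
  have "poly h c \<noteq> 0" using simple[OF True] unfolding h by (simp add: pderiv_mult pderiv_pCons pderiv_diff pderiv_smult)
  then show ?thesis using f by (intro exI[of _ "[:c, -1:]"] exI[of _ 1] exI[of _ "- h"]) auto
qed

lemma split_unit_roots:
  assumes adm: "admissible f"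
  shows "\<exists>d e h. d * e = [:1, 0, -1:] \<and> f = d * h \<and> (\<forall>z. norm z = 1 \<longrightarrow> poly (cpoly h) z \<noteq> 0)"
proof -
  obtain d1 e1 h1 where 1: "d1 * e1 = [:1, -1:]" "f = d1 * h1" "poly h1 1 \<noteq> 0"
    using split_root_at_unit[of 1 f] adm unfolding admissible_def by auto
  have "poly (pderiv h1) (- 1) \<noteq> 0" if "poly h1 (- 1) = 0"
    using adm that unfolding admissible_def 1(2) by (auto simp: pderiv_mult dest: spec[of _ "- 1"])
  then obtain d2 e2 h2 where 2: "d2 * e2 = [:- 1, -1:]" "h1 = d2 * h2" "poly h2 (- 1) \<noteq> 0"
    using split_root_at_unit[of "- 1" h1] by auto
  have "poly (cpoly h2) z \<noteq> 0" if z: "norm z = 1" for z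
  proof
    assume z0: "poly (cpoly h2) z = 0"
    then have "poly (cpoly f) z = 0" unfolding 1(2) 2(2) by (simp add: cpoly_hom)
    then have "z \<in> \<real>" using adm z unfolding admissible_def by auto
    then obtain x where x: "z = of_real x" by (auto elim: Reals_cases)
    then have "poly h2 x = 0" "x = 1 \<or> x = - 1" using z0 z by (auto simp: abs_if split: if_splits)
    then show False using 1(3) 2(2,3) by auto
  qed
  moreover have "(d1 * d2) * (- (e1 * e2)) = [:1, 0, -1:]"
  proof -
    have "(d1 * d2) * (- (e1 * e2)) = - ((d1 * e1) * (d2 * e2))" by (simp add: mult_ac)
    then show ?thesis unfolding 1(1) 2(1) by simp
  qed
  moreover have "f = (d1 * d2) * h2" using 1(2) 2(2) by (simp add: mult_ac)
  ultimately show ?thesis by blast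
qed

text \<open>For \<open>|z| = 1\<close> the weight multiplied by a component of \<open>f\<close> is twice the real part of a function that is
  meromorphic in the disc: up to the factor \<open>z\<^sup>p\<close>, \<open>u\<close> is the value of \<open>f\<close>, with components \<open>X\<close> and \<open>Y\<close>.\<close>
lemma weight_real_part:
  fixes z u :: complex and X Y :: real
  assumes z: "norm z = 1" and u: "u = of_real X - z * of_real Y" and u0: "u \<noteq> 0"
  shows "X * (norm (1 - z\<^sup>2) / norm u)\<^sup>2 = 2 * Re ((1 - z\<^sup>2) / u)"
    and "Y * (norm (1 - z\<^sup>2) / norm u)\<^sup>2 = 2 * Re (cnj z * (1 - z\<^sup>2) / u)"
proof -
  obtain x y where xy: "z = Complex x y" by (cases z)
  have c: "x\<^sup>2 = 1 - y\<^sup>2" using z by (simp add: xy cmod_def)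
  have nu: "(norm u)\<^sup>2 = (X - x * Y)\<^sup>2 + (y * Y)\<^sup>2" by (simp add: cmod_power2 u xy)
  have nu0: "(norm u)\<^sup>2 \<noteq> 0" using u0 by simp
  have w: "Re (1 - z\<^sup>2) = 2 * y\<^sup>2" "Im (1 - z\<^sup>2) = - 2 * x * y"
    using c by (simp_all add: xy power2_eq_square)
  have cw: "Re (cnj z * (1 - z\<^sup>2)) = 0" "Im (cnj z * (1 - z\<^sup>2)) = - 2 * y"
  proof -
    have "Re (cnj z * (1 - z\<^sup>2)) = x * (2 * y\<^sup>2) + y * (- 2 * x * y)" using w by (simp add: xy)
    then show "Re (cnj z * (1 - z\<^sup>2)) = 0" by (simp add: power2_eq_square)
    have "Im (cnj z * (1 - z\<^sup>2)) = x * (- 2 * x * y) - y * (2 * y\<^sup>2)" using w by (simp add: xy)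
    also have "\<dots> = - 2 * y * (x\<^sup>2 + y\<^sup>2)" by (simp add: power2_eq_square algebra_simps)
    finally show "Im (cnj z * (1 - z\<^sup>2)) = - 2 * y" using c by simp
  qed
  have n1: "(norm (1 - z\<^sup>2))\<^sup>2 = 4 * y\<^sup>2"
  proof -
    have "(norm (1 - z\<^sup>2))\<^sup>2 = (2 * y\<^sup>2)\<^sup>2 + (- 2 * x * y)\<^sup>2" unfolding cmod_power2 w ..
    also have "\<dots> = 4 * y\<^sup>2 * (x\<^sup>2 + y\<^sup>2)" by (simp add: power2_eq_square algebra_simps)
    finally show ?thesis using c by simp
  qed
  have ru: "Re u = X - x * Y" "Im u = - (y * Y)" by (simp_all add: u xy)
  have re: "Re (v / u) = (Re v * Re u + Im v * Im u) / (norm u)\<^sup>2" for v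
    by (simp add: Re_divide cmod_power2)
  have "2 * (2 * y\<^sup>2 * (X - x * Y) + (- 2 * x * y) * - (y * Y)) = X * (4 * y\<^sup>2)"
    by (simp add: power2_eq_square algebra_simps)
  then show "X * (norm (1 - z\<^sup>2) / norm u)\<^sup>2 = 2 * Re ((1 - z\<^sup>2) / u)"
    unfolding re w ru power_divide n1 by (metis times_divide_eq_right)
  have "2 * (0 * (X - x * Y) + (- 2 * y) * - (y * Y)) = Y * (4 * y\<^sup>2)"
    by (simp add: power2_eq_square algebra_simps)
  then show "Y * (norm (1 - z\<^sup>2) / norm u)\<^sup>2 = 2 * Re (cnj z * (1 - z\<^sup>2) / u)"
    unfolding re cw ru power_divide n1 by (metis times_divide_eq_right)
qed

lemma circ_sq_eq_1:
  assumes "0 \<le> t" "t \<le> 1" "(circ t)\<^sup>2 = 1"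
  shows "t \<in> {0, 1/2, 1}"
proof -
  have "circ t = 1 \<or> circ t = - 1" using assms(3) by (simp add: power2_eq_1_iff)
  then have "sin (2 * pi * t) = 0" unfolding circ_def by (auto simp: complex_eq_iff)
  then obtain i :: int where "2 * pi * t = of_int i * pi" using sin_zero_iff_int2 by auto
  then have i: "2 * t = of_int i" by simp
  then have "0 \<le> i" "i \<le> 2" using assms(1,2) by linarith+
  then have "i = 0 \<or> i = 1 \<or> i = 2" by linarith
  then show ?thesis using i by auto
qed

section \<open>The spectral measure of an admissible polynomial\<close>

text \<open>The functional is integration against the spectral measure up to normalization.  By
  \<open>weight_real_part\<close> the integrals of \<open>A q\<close> and \<open>B q\<close> are real parts of contour integrals; their residues at
  the roots in the disc cancel against the point masses.  For \<open>B q\<close> a simple pole at 0 remains, and it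
  yields the coefficient of degree \<open>p - 1\<close> of \<open>q\<close>.  This value shows below that \<open>B\<close> has exact degree
  \<open>p - 1\<close> and a positive leading coefficient.\<close>
lemma spectral_functional:
  fixes f A B :: "real poly"
  assumes adm: "admissible f" and p: "p \<ge> 1"
    and dec: "\<And>z. z \<noteq> 0 \<Longrightarrow> poly (cpoly f) z =
       z ^ p * (poly (cpoly A) (z + inverse z) - z * poly (cpoly B) (z + inverse z))"
    and f0: "poly f 0 = 1"
  shows "\<exists>L :: real poly \<Rightarrow> real. (\<forall>q r. L (q + r) = L q + L r) \<and> (\<forall>c q. L (smult c q) = c * L q) \<and>
    (\<forall>q. q \<noteq> 0 \<longrightarrow> L (q * q) > 0) \<and>
    (\<forall>q. degree q < p \<longrightarrow> L (A * q) = 0 \<and> L (B * q) = 2 * coeff q (p - 1))"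
proof -
  obtain d e h where de: "d * e = [:1, 0, -1:]" and f: "f = d * h"
    and hc: "\<And>z. norm z = 1 \<Longrightarrow> poly (cpoly h) z \<noteq> 0"
    using split_unit_roots[OF adm] by blast
  have dez: "poly (cpoly d) z * poly (cpoly e) z = 1 - z\<^sup>2" for z
  proof -
    have "poly (cpoly d) z * poly (cpoly e) z = poly (cpoly (d * e)) z" by (simp add: cpoly_hom)
    then show ?thesis unfolding de by (simp add: power2_eq_square)
  qed
  have der: "poly d x * poly e x = 1 - x\<^sup>2" for x
  proof -
    have "poly d x * poly e x = poly (d * e) x" by simp
    then show ?thesis unfolding de by (simp add: power2_eq_square)
  qed
  have fz: "poly (cpoly f) z = poly (cpoly d) z * poly (cpoly h) z" for z by (simp add: f cpoly_hom)
  define Z where "Z = {s. \<bar>s\<bar> < 1 \<and> poly f s = 0}"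
  have fnz: "f \<noteq> 0" using f0 by auto
  then have hnz: "h \<noteq> 0" using f by auto
  have finZ: "finite Z" unfolding Z_def using poly_roots_finite[OF fnz] by (rule rev_finite_subset) auto
  have sq_less: "z\<^sup>2 \<noteq> 1" if "norm z < 1" for z :: complex
    using that by (metis norm_one norm_power power_less_one_iff less_irrefl norm_ge_zero zero_less_numeral power2_eq_1_iff norm_minus_cancel)
  have rootsD: "{z. norm z < 1 \<and> poly (cpoly h) z = 0} = of_real ` Z"
  proof -
    have "poly (cpoly h) z = 0 \<longleftrightarrow> poly (cpoly f) z = 0" if "norm z < 1" for z
      using dez[of z] sq_less[OF that] fz[of z] by auto
    moreover have "z \<in> \<real>" if "norm z < 1" "poly (cpoly f) z = 0" for z
      using adm that unfolding admissible_def by auto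
    ultimately show ?thesis by (force simp: Z_def elim!: Reals_cases)
  qed
  have s0: "s \<noteq> 0" if "s \<in> Z" for s using that f0 unfolding Z_def by auto
  have hs: "poly h s = 0" "poly e s / poly (pderiv h) s = (1 - s\<^sup>2) / poly (pderiv f) s"
    "poly (pderiv h) s \<noteq> 0" "poly (pderiv f) s \<noteq> 0"
    and wpos: "s * poly (pderiv f) s * poly f (inverse s) > 0" if "s \<in> Z" for s
  proof -
    have s: "\<bar>s\<bar> < 1" "poly f s = 0" using that by (auto simp: Z_def)
    have "s\<^sup>2 < 1" using s by (simp add: abs_square_less_1)
    then have d: "poly d s \<noteq> 0" "poly e s \<noteq> 0" using der[of s] by auto
    show 1: "poly h s = 0" using s(2) d(1) f by simp
    show 2: "s * poly (pderiv f) s * poly f (inverse s) > 0" using adm s unfolding admissible_def by auto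
    then show 3: "poly (pderiv f) s \<noteq> 0" by auto
    have 4: "poly (pderiv f) s = poly d s * poly (pderiv h) s" using 1 by (simp add: f pderiv_mult)
    then show "poly (pderiv h) s \<noteq> 0" using 3 by auto
    then show "poly e s / poly (pderiv h) s = (1 - s\<^sup>2) / poly (pderiv f) s"
      unfolding 4 using der[of s] d by (simp add: field_simps)
  qed
  \<comment> \<open>The masses are dictated by the residues: \<open>w s * B(E s)\<close> has to be minus twice the residue of the
    integrand for \<open>B\<close>, see \<open>wB\<close>.\<close>
  define w where "w s = 2 * (1 - s\<^sup>2)\<^sup>2 / (s ^ 3 * poly (pderiv f) s * poly f (inverse s))" for s
  define E where "E s = s + inverse s" for s :: real
  have w: "w s > 0" if "s \<in> Z" for s
  proof -
    have "s\<^sup>2 < 1" using that by (simp add: Z_def abs_square_less_1)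
    moreover have "s\<^sup>2 * (s * poly (pderiv f) s * poly f (inverse s)) > 0"
      by (rule mult_pos_pos) (use wpos[OF that] s0[OF that] in auto)
    then have "s ^ 3 * poly (pderiv f) s * poly f (inverse s) > 0"
      by (simp only: power2_eq_square power3_eq_cube mult.assoc)
    ultimately show ?thesis unfolding w_def by (intro divide_pos_pos) auto
  qed
  have decr: "poly f x = x ^ p * (poly A (x + inverse x) - x * poly B (x + inverse x))" if "x \<noteq> 0" for x
  proof -
    have "complex_of_real x + inverse (complex_of_real x) = complex_of_real (x + inverse x)" by simp
    then have "complex_of_real (poly f x) = complex_of_real (x ^ p * (poly A (x + inverse x) - x * poly B (x + inverse x)))"
      using dec[of "of_real x"] that by (simp del: of_real_add of_real_inverse)
    then show ?thesis by (simp only: of_real_eq_iff)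
  qed
  have AB: "poly A (E s) = s * poly B (E s)" if "s \<in> Z" for s
    using decr[OF s0[OF that]] that s0[OF that] by (simp add: Z_def E_def)
  have wB: "w s * poly B (E s) = - 2 * (s ^ (p - 1) * (poly e s / poly (pderiv h) s)) / s" if "s \<in> Z" for s
  proof -
    have nz: "s \<noteq> 0" "s\<^sup>2 \<noteq> 1" "poly (pderiv f) s \<noteq> 0"
      using s0[OF that] hs[OF that] that by (auto simp: Z_def abs_square_eq_1)
    have i: "poly f (inverse s) = inverse s ^ p * ((s - inverse s) * poly B (E s))"
      using decr[of "inverse s"] AB[OF that] nz(1) by (simp add: E_def add.commute algebra_simps)
    then have B: "poly B (E s) \<noteq> 0" using wpos[OF that] by auto
    obtain m where m: "p = Suc m" using p by (cases p) auto
    have fi: "s ^ 3 * poly (pderiv f) s * poly f (inverse s) = s ^ 2 * poly (pderiv f) s * ((s\<^sup>2 - 1) * poly B (E s)) / s ^ p"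
      unfolding i using nz(1) by (simp add: field_simps power2_eq_square power3_eq_cube)
    have "w s * poly B (E s) = 2 * (1 - s\<^sup>2)\<^sup>2 * s ^ p / (s ^ 2 * poly (pderiv f) s * (s\<^sup>2 - 1))"
    proof -
      have "k / (X * (c * \<beta>) / P) * \<beta> = k * P / (X * c)" if "\<beta> \<noteq> 0" for k X c \<beta> P :: real
        using that by simp
      then show ?thesis unfolding w_def fi using B by blast
    qed
    also have "\<dots> = - 2 * (s ^ (p - 1) * ((1 - s\<^sup>2) / poly (pderiv f) s)) / s"
    proof -
      have "(1 - s\<^sup>2)\<^sup>2 = - ((1 - s\<^sup>2) * (s\<^sup>2 - 1))" by (simp add: power2_eq_square algebra_simps)
      moreover have "2 * (- (c' * c)) * (s * s ^ m) / (s ^ 2 * g * c) = - 2 * (s ^ m * (c' / g)) / s"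
        if "c \<noteq> 0" "g \<noteq> 0" for c c' g :: real
        using that nz(1) by (simp add: field_simps power2_eq_square)
      ultimately show ?thesis using nz(2,3) by (simp add: m)
    qed
    finally show ?thesis using hs(2)[OF that] by simp
  qed
  define x where "x t = 2 * cos (2 * pi * t)" for t :: real
  define \<rho> where "\<rho> t = (norm (poly (cpoly e) (circ t)) / norm (poly (cpoly h) (circ t)))\<^sup>2" for t
  define L where "L q = integral {0..1} (\<lambda>t. poly q (x t) * \<rho> t) + (\<Sum>s\<in>Z. w s * poly q (E s))" for q
  have cont: "continuous_on {0..1} (\<lambda>t. poly q (x t) * \<rho> t)" for q
    unfolding x_def \<rho>_def using hc by (intro continuous_intros) auto
  have intg: "(\<lambda>t. poly q (x t) * \<rho> t) integrable_on {0..1}" for q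
    by (rule integrable_continuous_real[OF cont])
  have add: "L (q + r) = L q + L r" for q r
    using integral_add[OF intg[of q] intg[of r]]
    by (simp add: L_def algebra_simps sum.distrib)
  have smult: "L (smult c q) = c * L q" for c q
    by (simp add: L_def algebra_simps sum_distrib_left)
  have pos: "L (q * q) > 0" if q: "q \<noteq> 0" for q
  proof -
    let ?g = "\<lambda>t. poly (q * q) (x t) * \<rho> t"
    have g0: "?g t \<ge> 0" for t by (simp add: \<rho>_def)
    have "integral {0..1} ?g \<noteq> 0"
    proof
      assume "integral {0..1} ?g = 0"
      then have zero: "?g t = 0" if "t \<in> {0..1}" for t
        using integral_eq_0_iff[OF cont[of "q * q"]] g0 that by auto
      have "poly q y = 0" if y: "y \<in> {-2<..<2}" for y
      proof -
        define t where "t = arccos (y / 2) / (2 * pi)"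
        have a: "0 < arccos (y / 2)" "arccos (y / 2) < pi"
          using arccos_lt_bounded[of "y / 2"] y by auto
        then have t: "0 < t" "t < 1 / 2" by (auto simp: t_def field_simps)
        have "x t = y" unfolding x_def t_def using y by simp
        moreover have "poly (cpoly e) (circ t) \<noteq> 0"
        proof
          assume "poly (cpoly e) (circ t) = 0"
          then have "(circ t)\<^sup>2 = 1" using dez[of "circ t"] by simp
          then show False using circ_sq_eq_1[of t] t by auto
        qed
        ultimately show ?thesis using zero[of t] t hc[of "circ t"] by (simp add: \<rho>_def)
      qed
      then have "{-2<..<2} \<subseteq> {y. poly q y = 0}" by auto
      then have "finite {-2<..<2::real}" using poly_roots_finite[OF q] by (rule finite_subset)
      then show False using infinite_Ioo[of "-2" "2::real"] by simp
    qed
    moreover have "integral {0..1} ?g \<ge> 0" using g0 by (intro integral_nonneg[OF intg]) auto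
    moreover have "(\<Sum>s\<in>Z. w s * poly (q * q) (E s)) \<ge> 0"
      using w by (intro sum_nonneg) (simp add: less_imp_le)
    ultimately show ?thesis unfolding L_def by linarith
  qed
  have orth: "L (A * q) = 0 \<and> L (B * q) = 2 * coeff q (p - 1)" if q: "degree q < p" for q
  proof -
    have "degree q \<le> p - 1" using q by simp
    then obtain Q where Q0: "coeff Q 0 = coeff q (p - 1)"
      and Q: "\<And>z. z \<noteq> 0 \<Longrightarrow> poly (cpoly Q) z = z ^ (p - 1) * poly (cpoly q) (z + inverse z)"
      using palindromic_lift by blast
    have Qs: "poly Q s = s ^ (p - 1) * poly q (E s)" if "s \<noteq> 0" for s
    proof -
      have "complex_of_real s + inverse (complex_of_real s) = complex_of_real (E s)" by (simp add: E_def)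
      then have "complex_of_real (poly Q s) = complex_of_real (s ^ (p - 1) * poly q (E s))"
        using Q[of "of_real s"] that by (simp del: of_real_add of_real_inverse)
      then show ?thesis by (simp only: of_real_eq_iff)
    qed
    let ?N = "cpoly (Q * e)"
    have key: "poly (A * q) (x t) * \<rho> t = 2 * Re (circ t * (poly ?N (circ t) / poly (cpoly h) (circ t)))"
      "poly (B * q) (x t) * \<rho> t = 2 * Re (circ t * (poly ?N (circ t) / poly (cpoly ([:0, 1:] * h)) (circ t)))"
      \<comment> \<open>The excluded parameters are those with \<open>z\<^sup>2 = 1\<close>, where \<open>f\<close> may vanish.\<close>
      if t: "t \<in> {0..1} - {0, 1/2, 1}" for t
    proof -
      let ?z = "circ t" and ?X = "poly A (x t)" and ?Y = "poly B (x t)" and ?v = "poly q (x t)"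
      let ?u = "of_real ?X - ?z * of_real ?Y"
      have xt: "?z + inverse ?z = of_real (x t)" by (simp add: circ_joukowski x_def)
      have z2: "1 - ?z\<^sup>2 \<noteq> 0" using circ_sq_eq_1[of t] t by auto
      then have dz: "poly (cpoly d) ?z \<noteq> 0" using dez[of ?z] by auto
      have fu: "poly (cpoly f) ?z = ?z ^ p * ?u"
        using dec[of ?z] unfolding xt by simp
      have hz: "poly (cpoly h) ?z \<noteq> 0" using hc by simp
      have u0: "?u \<noteq> 0" using fu fz[of ?z] dz hz by auto
      have eh: "poly (cpoly e) ?z / poly (cpoly h) ?z = (1 - ?z\<^sup>2) / (?z ^ p * ?u)"
        unfolding fu[symmetric] fz dez[symmetric] using dz by simp
      have rho: "\<rho> t = (norm (1 - ?z\<^sup>2) / norm ?u)\<^sup>2"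
      proof -
        have "\<rho> t = (norm (poly (cpoly e) ?z / poly (cpoly h) ?z))\<^sup>2" by (simp add: \<rho>_def norm_divide)
        also have "\<dots> = (norm (1 - ?z\<^sup>2) / norm ?u)\<^sup>2" unfolding eh by (simp add: norm_divide norm_mult norm_power)
        finally show ?thesis .
      qed
      obtain m where m: "p = Suc m" using p by (cases p) auto
      have Nz: "poly ?N ?z / poly (cpoly h) ?z = of_real ?v * (inverse ?z * ((1 - ?z\<^sup>2) / ?u))"
      proof -
        have "poly ?N ?z / poly (cpoly h) ?z = poly (cpoly Q) ?z * (poly (cpoly e) ?z / poly (cpoly h) ?z)"
          by (simp add: cpoly_hom)
        also have "\<dots> = of_real ?v * (inverse ?z * ((1 - ?z\<^sup>2) / ?u))"
          unfolding eh Q[OF circ_nonzero] xt poly_cpoly_of_real using u0 by (simp add: m field_simps)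
        finally show ?thesis .
      qed
      have Reof: "Re (of_real r * c) = r * Re c" for r c by simp
      have "poly (A * q) (x t) * \<rho> t = ?v * (?X * \<rho> t)" by simp
      also have "\<dots> = ?v * (2 * Re ((1 - ?z\<^sup>2) / ?u))"
        unfolding rho weight_real_part(1)[OF norm_circ refl u0] ..
      also have "\<dots> = 2 * Re (of_real ?v * ((1 - ?z\<^sup>2) / ?u))" unfolding Reof by simp
      also have "of_real ?v * ((1 - ?z\<^sup>2) / ?u) = ?z * (poly ?N ?z / poly (cpoly h) ?z)"
        unfolding Nz by simp
      finally show "poly (A * q) (x t) * \<rho> t = 2 * Re (?z * (poly ?N ?z / poly (cpoly h) ?z))" .
      have "poly (B * q) (x t) * \<rho> t = ?v * (?Y * \<rho> t)" by simp
      also have "\<dots> = ?v * (2 * Re (cnj ?z * (1 - ?z\<^sup>2) / ?u))"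
        unfolding rho weight_real_part(2)[OF norm_circ refl u0] ..
      also have "\<dots> = 2 * Re (of_real ?v * (cnj ?z * (1 - ?z\<^sup>2) / ?u))" unfolding Reof by simp
      also have "of_real ?v * (cnj ?z * (1 - ?z\<^sup>2) / ?u) = poly ?N ?z / poly (cpoly h) ?z"
        unfolding Nz inverse_circ by simp
      also have "\<dots> = ?z * (poly ?N ?z / poly (cpoly ([:0, 1:] * h)) ?z)"
        unfolding cpoly_mult by simp
      finally show "poly (B * q) (x t) * \<rho> t = 2 * Re (?z * (poly ?N ?z / poly (cpoly ([:0, 1:] * h)) ?z))" .
    qed
    have real_int: "integral {0..1} (\<lambda>t. poly r (x t) * \<rho> t) = 2 * S"
      if ints: "((\<lambda>t. circ t * (poly N (circ t) / poly H (circ t))) has_integral of_real S) {0..1}"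
        and eq: "\<And>t. t \<in> {0..1} - {0, 1/2, 1} \<Longrightarrow> poly r (x t) * \<rho> t = 2 * Re (circ t * (poly N (circ t) / poly H (circ t)))"
      for r N H S
    proof -
      have "((\<lambda>t. 2 * Re (circ t * (poly N (circ t) / poly H (circ t)))) has_integral 2 * S) {0..1}"
        using has_integral_mult_right[OF has_integral_linear[OF ints bounded_linear_Re]] by (simp add: o_def)
      then have "((\<lambda>t. poly r (x t) * \<rho> t) has_integral 2 * S) {0..1}"
        by (rule has_integral_spike_finite[of "{0, 1/2, 1}", rotated 2]) (use eq in auto)
      then show ?thesis by (rule integral_unique)
    qed
    have injZ: "inj_on complex_of_real Z" by (auto intro: inj_onI)
    let ?r = "\<lambda>s. poly (Q * e) s / poly (pderiv h) s"
    have intA: "integral {0..1} (\<lambda>t. poly (A * q) (x t) * \<rho> t) = 2 * (\<Sum>s\<in>Z. ?r s)"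
    proof (rule real_int[OF _ key(1)])
      have "((\<lambda>t. circ t * (poly ?N (circ t) / poly (cpoly h) (circ t))) has_integral
        (\<Sum>z\<in>of_real ` Z. poly ?N z / poly (pderiv (cpoly h)) z)) {0..1}"
        unfolding rootsD[symmetric]
      proof (rule circle_integral_rational)
        fix z assume "norm z < 1" "poly (cpoly h) z = 0"
        then have "z \<in> of_real ` Z" using rootsD by auto
        then show "poly (pderiv (cpoly h)) z \<noteq> 0" using hs(3) by (auto simp: pderiv_cpoly)
      qed (use hc in auto)
      also have "(\<Sum>z\<in>of_real ` Z. poly ?N z / poly (pderiv (cpoly h)) z) = of_real (\<Sum>s\<in>Z. ?r s)"
        unfolding sum.reindex[OF injZ] by (simp add: pderiv_cpoly)
      finally show "((\<lambda>t. circ t * (poly ?N (circ t) / poly (cpoly h) (circ t))) has_integral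
        complex_of_real (\<Sum>s\<in>Z. ?r s)) {0..1}" .
    qed auto
    have Z0: "0 \<notin> Z" using s0 by auto
    have h0: "poly h 0 \<noteq> 0" "poly e 0 = poly h 0"
    proof -
      have "poly d 0 * poly h 0 = 1" using f0 f by simp
      moreover from this show "poly h 0 \<noteq> 0" by auto
      ultimately show "poly e 0 = poly h 0" using der[of 0] by (metis diff_zero mult_left_cancel mult_zero_left zero_neq_one zero_power2)
    qed
    let ?h1 = "[:0, 1:] * h"
    have intB: "integral {0..1} (\<lambda>t. poly (B * q) (x t) * \<rho> t) = 2 * (coeff q (p - 1) + (\<Sum>s\<in>Z. ?r s / s))"
    proof (rule real_int[OF _ key(2)])
      have rootsD1: "{z. norm z < 1 \<and> poly (cpoly ?h1) z = 0} = of_real ` insert 0 Z"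
        using rootsD unfolding cpoly_mult by auto
      have dh1: "poly (pderiv ?h1) s = poly h s + s * poly (pderiv h) s" for s
        by (simp add: pderiv_pCons)
      have "((\<lambda>t. circ t * (poly ?N (circ t) / poly (cpoly ?h1) (circ t))) has_integral
        (\<Sum>z\<in>of_real ` insert 0 Z. poly ?N z / poly (pderiv (cpoly ?h1)) z)) {0..1}"
        unfolding rootsD1[symmetric]
      proof (rule circle_integral_rational)
        fix z assume "norm z < 1" "poly (cpoly ?h1) z = 0"
        then have "z \<in> of_real ` insert 0 Z" using rootsD1 by blast
        then obtain s where s: "s \<in> insert 0 Z" "z = of_real s" by blast
        have "poly (pderiv ?h1) s \<noteq> 0"
          unfolding dh1 using s(1) hs(1,3) s0 h0(1) by auto
        then show "poly (pderiv (cpoly ?h1)) z \<noteq> 0"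
          unfolding pderiv_cpoly s(2) poly_cpoly_of_real using of_real_eq_0_iff by blast
      next
        fix z :: complex assume "norm z = 1"
        then show "poly (cpoly ?h1) z \<noteq> 0" unfolding cpoly_mult using hc by auto
      qed
      also have "(\<Sum>z\<in>of_real ` insert 0 Z. poly ?N z / poly (pderiv (cpoly ?h1)) z)
        = (\<Sum>s\<in>insert 0 Z. of_real (poly (Q * e) s / poly (pderiv ?h1) s))"
        by (subst sum.reindex) (auto intro: inj_onI simp: pderiv_cpoly simp del: mult_pCons_left poly_mult)
      also have "\<dots> = of_real (\<Sum>s\<in>insert 0 Z. poly (Q * e) s / poly (pderiv ?h1) s)" by simp
      also have "(\<Sum>s\<in>insert 0 Z. poly (Q * e) s / poly (pderiv ?h1) s) = coeff q (p - 1) + (\<Sum>s\<in>Z. ?r s / s)"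
      proof -
        have "poly (Q * e) 0 / poly (pderiv ?h1) 0 = coeff q (p - 1)"
        proof -
          have "poly Q 0 = coeff q (p - 1)" using Q0 by (simp add: poly_0_coeff_0)
          then show ?thesis unfolding dh1 poly_mult h0(2) using h0(1) by simp
        qed
        moreover have "(\<Sum>s\<in>Z. poly (Q * e) s / poly (pderiv ?h1) s) = (\<Sum>s\<in>Z. ?r s / s)"
          unfolding dh1 by (rule sum.cong) (use hs(1) in auto)
        ultimately show ?thesis using finZ Z0 by simp
      qed
      finally show "((\<lambda>t. circ t * (poly ?N (circ t) / poly (cpoly ?h1) (circ t))) has_integral
        complex_of_real (coeff q (p - 1) + (\<Sum>s\<in>Z. ?r s / s))) {0..1}" .
    qed auto
    have termB: "w s * poly (B * q) (E s) = - 2 * (?r s / s)" if "s \<in> Z" for s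
    proof -
      have "w s * poly (B * q) (E s) = (w s * poly B (E s)) * poly q (E s)" by simp
      then show ?thesis unfolding wB[OF that] using Qs[OF s0[OF that]] by simp
    qed
    have termA: "w s * poly (A * q) (E s) = - 2 * ?r s" if "s \<in> Z" for s
    proof -
      have "w s * poly (A * q) (E s) = s * (w s * poly (B * q) (E s))" using AB[OF that] by simp
      then show ?thesis unfolding termB[OF that] using s0[OF that] by simp
    qed
    show ?thesis unfolding L_def intA intB
      by (simp add: termA termB sum_distrib_left[symmetric] sum_negf del: poly_mult times_divide_eq_right)
  qed
  show ?thesis using add smult pos orth by (intro exI[of _ L]) blast
qed

section \<open>Reconstruction of the Jacobi operator\<close>

text \<open>Favard's theorem read downwards.  The remainder \<open>Z = (x - \<beta>) Y - X\<close> is orthogonal to all lower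
  degrees, and \<open>L(Z q)\<close> is the top coefficient of \<open>q\<close> times \<open>L(Y\<^sup>2)\<close>.  With \<open>q = x\<^sup>n\<close> this shows
  \<open>Z \<noteq> 0\<close>, and with \<open>q = Z\<close> that the leading coefficient of \<open>Z\<close>, the next \<open>a\<^sup>2\<close>, is positive.\<close>
lemma favard_descent:
  fixes L :: "real poly \<Rightarrow> real"
  assumes add: "\<And>q r. L (q + r) = L q + L r" and smult: "\<And>c q. L (smult c q) = c * L q"
    and pos: "\<And>q. q \<noteq> 0 \<Longrightarrow> L (q * q) > 0"
    and X: "degree X \<le> Suc n" "coeff X (Suc n) = 1" "\<And>q. degree q \<le> n \<Longrightarrow> L (X * q) = 0"
    and Y: "degree Y \<le> n" "coeff Y n = 1" "\<And>q. degree q < n \<Longrightarrow> L (Y * q) = 0"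
  shows "\<exists>a b. (\<forall>i\<ge>1. a i > 0) \<and> orth_poly a b (Suc n) = X \<and> orth_poly a b n = Y"
  using X Y
proof (induction n arbitrary: X Y)
  case 0
  have "X = [:coeff X 0, 1:]"
    by (rule poly_eqI) (use 0 in \<open>auto simp: coeff_pCons coeff_eq_0 split: nat.splits\<close>)
  moreover have "Y = 1"
    by (rule poly_eqI) (use 0 in \<open>auto simp: one_pCons coeff_pCons coeff_eq_0 split: nat.splits\<close>)
  ultimately show ?case
    by (intro exI[of _ "\<lambda>_. 1"] exI[of _ "\<lambda>_. - coeff X 0"]) simp
next
  case (Suc n)
  note X = Suc.prems(1-3) and Y = Suc.prems(4-6)
  have diff: "L (q - r) = L q - L r" for q r
    using add[of "q - r" r] by simp
  define \<beta> where "\<beta> = coeff Y n - coeff X (Suc n)"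
  define Z where "Z = [:- \<beta>, 1:] * Y - X"
  have dZ: "degree Z \<le> n"
  proof (rule degree_le, intro allI impI)
    fix i assume "n < i"
    then consider "i = Suc n" | "i = Suc (Suc n)" | "i > Suc (Suc n)" by linarith
    then show "coeff Z i = 0"
    proof cases
      case 3
      then obtain j where "i = Suc j" "j > Suc n" by (cases i) auto
      then show ?thesis using X(1) Y(1) by (simp add: Z_def coeff_eq_0)
    qed (use X Y in \<open>simp_all add: Z_def \<beta>_def coeff_eq_0\<close>)
  qed
  have LZ: "L (Z * q) = coeff q n * L (Y * Y)" if q: "degree q \<le> n" for q
  proof -
    define r where "r = [:- \<beta>, 1:] * q - smult (coeff q n) Y"
    have "degree r \<le> n"
    proof (rule degree_le, intro allI impI)
      fix i assume "n < i"
      then obtain j where j: "i = Suc j" "j \<ge> n" by (cases i) auto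
      show "coeff r i = 0"
        by (cases "j = n") (use j q Y(1,2) in \<open>auto simp: r_def coeff_eq_0\<close>)
    qed
    then have r: "L (Y * r) = 0" using Y(3) by simp
    have "Z * q = Y * (r + smult (coeff q n) Y) - X * q"
      by (simp add: Z_def r_def algebra_simps)
    then have "L (Z * q) = L (Y * r) + coeff q n * L (Y * Y) - L (X * q)"
      by (simp add: diff add smult distrib_left)
    then show ?thesis using r X(3)[of q] q by simp
  qed
  have YY: "L (Y * Y) > 0" using Y(2) by (intro pos) auto
  define \<gamma> where "\<gamma> = coeff Z n"
  have "L (Z * monom 1 n) > 0" using LZ[of "monom 1 n"] YY by (simp add: degree_monom_eq)
  moreover have "L 0 = 0" using smult[of 0 0] by simp
  ultimately have "Z \<noteq> 0" by auto
  then have "L (Z * Z) > 0" by (rule pos)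
  then have \<gamma>: "\<gamma> > 0" using LZ[OF dZ] YY by (simp add: \<gamma>_def zero_less_mult_iff)
  obtain a b where ab: "\<forall>i\<ge>1. a i > 0" "orth_poly a b (Suc n) = Y" "orth_poly a b n = smult (1 / \<gamma>) Z"
  proof -
    have "\<exists>a b. (\<forall>i\<ge>1. a i > 0) \<and> orth_poly a b (Suc n) = Y \<and> orth_poly a b n = smult (1 / \<gamma>) Z"
    proof (rule Suc.IH)
      show "coeff (smult (1 / \<gamma>) Z) n = 1" using \<gamma> by (simp add: \<gamma>_def)
      show "L (smult (1 / \<gamma>) Z * q) = 0" if "degree q < n" for q
        using LZ[of q] that by (simp add: smult coeff_eq_0)
    qed (use Y dZ in \<open>auto intro: order_trans[OF degree_smult_le]\<close>)
    then show ?thesis using that by blast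
  qed
  define a' where "a' = a(Suc n := sqrt \<gamma>)"
  define b' where "b' = b(Suc (Suc n) := \<beta>)"
  have 1: "orth_poly a' b' (Suc n) = Y" unfolding ab(2)[symmetric]
    by (rule orth_poly_cong) (auto simp: a'_def b'_def)
  have 2: "orth_poly a' b' n = smult (1 / \<gamma>) Z" unfolding ab(3)[symmetric]
    by (rule orth_poly_cong) (auto simp: a'_def b'_def)
  have "orth_poly a' b' (Suc (Suc n)) = [:- \<beta>, 1:] * Y - Z"
    using \<gamma> unfolding orth_poly.simps(3) 1 2 by (simp add: a'_def b'_def)
  then have "orth_poly a' b' (Suc (Suc n)) = X" by (simp add: Z_def)
  moreover have "\<forall>i\<ge>1. a' i > 0" using ab(1) \<gamma> by (auto simp: a'_def)
  ultimately show ?case using 1 by blast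
qed

lemma cpoly_eqI_nonzero:
  assumes "\<And>z. z \<noteq> 0 \<Longrightarrow> poly (cpoly f) z = poly (cpoly g) z"
  shows "f = g"
proof -
  have "- {0} \<subseteq> {z. poly (cpoly f - cpoly g) z = 0}" using assms by auto
  moreover have "infinite (- {0 :: complex})"
    by (simp add: Compl_eq_Diff_UNIV infinite_UNIV_char_0)
  ultimately have "cpoly f - cpoly g = 0"
    using finite_subset poly_roots_finite by blast
  then show ?thesis by simp
qed

lemma bounded_eventually_const:
  fixes h :: "nat \<Rightarrow> real"
  assumes "\<And>x. x > n \<Longrightarrow> h x = c"
  shows "bounded (h ` S)"
proof (rule bounded_subset)
  show "h ` S \<subseteq> insert c (h ` {..n})"
  proof
    fix y assume "y \<in> h ` S"
    then obtain x where "y = h x" by blast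
    then show "y \<in> insert c (h ` {..n})" using assms[of x] by (cases "x \<le> n") auto
  qed
  show "bounded (insert c (h ` {..n}))" by (intro finite_imp_bounded) auto
qed

lemma has_jost_rootsD:
  assumes "has_jost_roots k a b R" "k \<ge> 1"
  defines "p \<equiv> (k + 1) div 2"
  shows "a 0 = 1" "\<And>x. x \<ge> 1 \<Longrightarrow> a x > 0" "\<And>x. x > p \<Longrightarrow> a x = 1" "\<And>x. x > p \<Longrightarrow> b x = 0"
    "odd k \<Longrightarrow> a p = 1" "proots (cpoly (jost_poly a b p)) = R"
    "jost_function a b p = smult (of_real (inverse (\<Prod>i=1..p. a i))) (cpoly (jost_poly a b p))"
    "inverse (\<Prod>i=1..p. a i) \<noteq> 0" "\<And>x. x > k \<Longrightarrow> perturbation a b x = 0"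
proof -
  have jc: "jacobi_coeffs a b" and pc: "perturbation a b \<in> pert_class k"
    and R: "proots (jost_function a b p) = R"
    using assms by (auto simp: has_jost_roots_def)
  show a0: "a 0 = 1" using jc by (simp add: jacobi_coeffs_def)
  show apos: "a x > 0" if "x \<ge> 1" for x using jc that by (simp add: jacobi_coeffs_def)
  show tail: "perturbation a b x = 0" if "x > k" for x using pc that by (auto simp: pert_class_def)
  have k2: "k \<le> 2 * p" "2 * p \<le> Suc k" by (auto simp: p_def)
  show t1: "a x = 1" if "x > p" for x
    using tail[of "2 * x"] k2 that by (simp add: perturbation_def)
  show t2: "b x = 0" if "x > p" for x
  proof -
    have "2 * x - 1 > k" "odd (2 * x - 1)" using k2 that by auto
    then show ?thesis using tail[of "2 * x - 1"] that by (simp add: perturbation_def)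
  qed
  show "a p = 1" if "odd k"
    using tail[of "2 * p"] that by (simp add: perturbation_def p_def)
  have p1: "p \<ge> 1" using assms(2) by (simp add: p_def)
  show jf: "jost_function a b p = smult (of_real (inverse (\<Prod>i=1..p. a i))) (cpoly (jost_poly a b p))"
    by (rule jost_function_eq_jost_poly) (use a0 apos t1 t2 p1 in auto)
  have "(\<Prod>i=1..p. a i) > 0" using apos by (intro prod_pos) auto
  then show nz: "inverse (\<Prod>i=1..p. a i) \<noteq> 0" by (simp only: inverse_nonzero_iff_nonzero)
  show "proots (cpoly (jost_poly a b p)) = R"
    using R unfolding jf by (subst (asm) proots_smult) (use nz in \<open>simp_all only: of_real_eq_0_iff not_False_eq_True\<close>)
qed

text \<open>The degree of the Jost function decides which entry of the perturbation is the last nonzero one.\<close>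
lemma has_jost_rootsI:
  assumes a0: "a 0 = 1" and apos: "\<And>x. x \<ge> 1 \<Longrightarrow> a x > 0"
    and tail: "\<And>x. x > p \<Longrightarrow> a x = 1" "\<And>x. x > p \<Longrightarrow> b x = 0"
    and k: "k \<ge> 1" "p = (k + 1) div 2" and deg: "degree (jost_poly a b p) = k"
  shows "has_jost_roots k a b (proots (cpoly (jost_poly a b p)))"
proof -
  have p1: "p \<ge> 1" using k by simp
  have jf: "jost_function a b p = smult (of_real (inverse (\<Prod>i=1..p. a i))) (cpoly (jost_poly a b p))"
    by (rule jost_function_eq_jost_poly) (use a0 apos tail p1 in auto)
  have "(\<Prod>i=1..p. a i) > 0" using apos by (intro prod_pos) auto
  then have "inverse (\<Prod>i=1..p. a i) \<noteq> 0" by (simp only: inverse_nonzero_iff_nonzero)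
  then have "proots (jost_function a b p) = proots (cpoly (jost_poly a b p))"
    unfolding jf by (intro proots_smult) (simp only: of_real_eq_0_iff not_False_eq_True)
  moreover have "jacobi_coeffs a b"
    using a0 apos bounded_eventually_const[of p a 1] bounded_eventually_const[of p b 0] tail
    by (simp add: jacobi_coeffs_def)
  moreover have "perturbation a b \<in> pert_class k"
  proof -
    have parity: "k = 2 * p \<or> k = 2 * p - 1" using k by linarith
    have odd_a: "a p = 1" if "k = 2 * p - 1"
      using degree_jost_poly_even[of p a b] p1 apos[of p] deg that by fastforce
    have z: "perturbation a b x = 0" if "x > k" for x
    proof (cases "even x")
      case True
      then obtain y where y: "x = 2 * y" by blast
      then have "a y = 1" using that parity odd_a tail(1)[of y] by (cases "y = p") auto
      then show ?thesis using y by (simp add: perturbation_def)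
    next
      case False
      then obtain y where y: "x = 2 * y + 1" by (auto elim: oddE)
      then have "Suc y > p" using that parity p1 by auto
      then show ?thesis using y tail(2)[of "Suc y"] by (simp add: perturbation_def)
    qed
    have "perturbation a b k \<noteq> 0"
    proof
      assume z0: "perturbation a b k = 0"
      show False
      proof (cases "k = 2 * p")
        case True
        then have "a p = 1" using z0 by (simp add: perturbation_def)
        then have "degree (jost_poly a b p) \<le> 2 * p - 1"
          using degree_jost_poly_odd[of p a b] degree_jost_poly_trivial[of p a b] p1
          by (cases "b p = 0") auto
        then show False using deg True p1 by simp
      next
        case False
        then have k': "k = 2 * p - 1" using parity by blast
        then have "odd k" "(k + 1) div 2 = p" using p1 by auto
        then have "b p = 0" using z0 by (simp add: perturbation_def)
        then show False using degree_jost_poly_trivial[of p a b] p1 odd_a[OF k'] deg k' by simp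
      qed
    qed
    moreover have "perturbation a b (2 * x) > - 1" if "x \<ge> 1" for x
      using apos[OF that] by (simp add: perturbation_def)
    ultimately show ?thesis unfolding pert_class_def
      using z bounded_eventually_const[of k "perturbation a b" 0] by auto
  qed
  ultimately show ?thesis using k by (simp add: has_jost_roots_def)
qed

text \<open>The converse of \<open>jost_poly_admissible\<close>.  The last coefficient is \<open>a\<^sub>p\<^sup>2 = \<beta>\<close>, the leading coefficient of
  \<open>B\<close>; the coefficients before it come from the descent, those after it are free.\<close>
theorem admissible_imp_jost:
  assumes adm: "admissible f" and f0: "poly f 0 = 1" and deg: "degree f = k"
    and k: "k \<ge> 1" "p = (k + 1) div 2"
  shows "\<exists>a b. jost_poly a b p = f \<and> has_jost_roots k a b (proots (cpoly f))"
proof -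
  have p1: "p \<ge> 1" using k by simp
  obtain n where n: "p = Suc n" using p1 by (cases p) auto
  have "degree f \<le> 2 * p" using deg k(2) by simp
  then obtain A B where AB: "degree A \<le> p" "\<forall>i\<ge>p. coeff B i = 0"
    and dec: "\<And>z. z \<noteq> 0 \<Longrightarrow> poly (cpoly f) z =
       z ^ p * (poly (cpoly A) (z + inverse z) - z * poly (cpoly B) (z + inverse z))"
    using joukowski_decomposition by blast
  have dB: "degree B \<le> n" using AB(2) n by (intro degree_le) auto
  have Ap: "coeff A p = 1"
  proof -
    obtain QA where QA: "coeff QA 0 = coeff A p"
      "\<And>z. z \<noteq> 0 \<Longrightarrow> poly (cpoly QA) z = z ^ p * poly (cpoly A) (z + inverse z)"
      using palindromic_lift[OF AB(1)] by blast
    obtain QB where QB: "\<And>z. z \<noteq> 0 \<Longrightarrow> poly (cpoly QB) z = z ^ n * poly (cpoly B) (z + inverse z)"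
      using palindromic_lift[OF dB] by blast
    have "f = QA - [:0, 0, 1:] * QB"
      by (rule cpoly_eqI_nonzero) (simp add: dec cpoly_hom QA(2) QB n algebra_simps)
    then have "coeff f 0 = coeff QA 0" by simp
    then show ?thesis using f0 QA(1) by (simp add: poly_0_coeff_0)
  qed
  obtain L where L: "\<And>q r. L (q + r) = L q + L r" "\<And>c q. L (smult c q) = c * L q"
    "\<And>q. q \<noteq> 0 \<Longrightarrow> L (q * q) > 0" "\<And>q. degree q < p \<Longrightarrow> L (A * q) = 0"
    "\<And>q. degree q < p \<Longrightarrow> L (B * q) = 2 * coeff q n"
    using spectral_functional[OF adm p1 dec f0] by (metis n diff_Suc_1)
  define \<beta> where "\<beta> = coeff B n"
  have "L (B * monom 1 n) = 2" using L(5)[of "monom 1 n"] n by (simp add: degree_monom_eq)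
  moreover have "L 0 = 0" using L(2)[of 0 0] by simp
  ultimately have "B \<noteq> 0" by auto
  then have "L (B * B) > 0" by (rule L(3))
  then have \<beta>: "\<beta> > 0" using L(5)[of B] dB n by (simp add: \<beta>_def)
  obtain a0 b0 where ab: "\<forall>i\<ge>1. a0 i > 0" "orth_poly a0 b0 p = A" "orth_poly a0 b0 n = smult (1 / \<beta>) B"
  proof -
    have "\<exists>a b. (\<forall>i\<ge>1. a i > 0) \<and> orth_poly a b (Suc n) = A \<and> orth_poly a b n = smult (1 / \<beta>) B"
    proof (rule favard_descent[of L])
      show "coeff (smult (1 / \<beta>) B) n = 1" using \<beta> by (simp add: \<beta>_def)
      show "L (smult (1 / \<beta>) B * q) = 0" if "degree q < n" for q
        using L(5)[of q] that n by (simp add: L(2) coeff_eq_0)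
    qed (use L AB(1) Ap n dB in \<open>auto intro: order_trans[OF degree_smult_le]\<close>)
    then show ?thesis using that n by blast
  qed
  define a where "a i = (if i = 0 \<or> i > p then 1 else if i = p then sqrt \<beta> else a0 i)" for i
  define b where "b i = (if i > p then 0 else b0 i)" for i
  have 1: "orth_poly a b p = A" unfolding ab(2)[symmetric]
    by (rule orth_poly_cong) (auto simp: a_def b_def)
  have 2: "orth_poly a b n = smult (1 / \<beta>) B" unfolding ab(3)[symmetric]
    by (rule orth_poly_cong) (auto simp: a_def b_def n)
  have ap: "(a p)\<^sup>2 = \<beta>" using \<beta> p1 by (simp add: a_def)
  have jp: "jost_poly a b p = f"
  proof (rule cpoly_eqI_nonzero)
    fix z :: complex assume z: "z \<noteq> 0"
    show "poly (cpoly (jost_poly a b p)) z = poly (cpoly f) z"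
      unfolding poly_jost_poly[OF z p1] ap 1 dec[OF z] using 2 \<beta> by (simp add: n cpoly_smult)
  qed
  moreover have "has_jost_roots k a b (proots (cpoly (jost_poly a b p)))"
    by (rule has_jost_rootsI) (use ab(1) \<beta> k deg jp in \<open>auto simp: a_def b_def\<close>)
  ultimately show ?thesis by auto
qed

section \<open>Root multisets and quadratic factors\<close>

definition root_poly :: "complex multiset \<Rightarrow> complex poly" where
  "root_poly R = (\<Prod>r\<in>#R. [:1, - inverse r:])"

lemma root_poly_union: "root_poly (R + S) = root_poly R * root_poly S"
  by (simp add: root_poly_def)

lemma root_poly_pair: "root_poly {#x, y#} = [:1, - (inverse x + inverse y), inverse (x * y):]"
  by (simp add: root_poly_def algebra_simps)

lemma poly_root_poly_0 [simp]: "poly (root_poly R) 0 = 1"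
  by (induction R) (auto simp: root_poly_def)

lemma root_poly_nonzero [simp]: "root_poly R \<noteq> 0"
  using poly_root_poly_0[of R] by (metis poly_0 zero_neq_one)

lemma proots_root_poly:
  assumes "0 \<notin># R"
  shows "proots (root_poly R) = R"
  using assms
proof (induction R)
  case (add r R)
  then have r: "r \<noteq> 0" by auto
  have "[:1, - inverse r:] = smult (- inverse r) [:- r, 1:]" using r by simp
  then have "proots [:1, - inverse r:] = {#r#}" using r by (simp del: smult_pCons)
  moreover have "root_poly (add_mset r R) = [:1, - inverse r:] * root_poly R"
    by (simp add: root_poly_def)
  moreover have "[:1, - inverse r:] \<noteq> 0" by simp
  ultimately show ?case using add by (simp add: proots_mult del: mult_pCons_left)
qed (simp add: root_poly_def)

lemma degree_root_poly:
  assumes "0 \<notin># R"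
  shows "degree (root_poly R) = size R"
  using size_proots_complex[of "root_poly R"] proots_root_poly[OF assms] by simp

lemma root_poly_proots:
  assumes "poly P 0 = 1"
  shows "root_poly (proots P) = P"
proof -
  have P: "P \<noteq> 0" using assms by auto
  then have "0 \<notin># proots P" using assms by simp
  then have "proots (root_poly (proots P)) = proots P" by (rule proots_root_poly)
  moreover define M where "M = (\<Prod>x\<in>#proots P. [:- x, 1:])"
  ultimately have "root_poly (proots P) = smult (lead_coeff (root_poly (proots P))) M"
    using complex_poly_decompose_multiset[of "root_poly (proots P)"] by simp
  moreover have "M = smult (inverse (lead_coeff P)) P"
  proof -
    have "P = smult (lead_coeff P) M" using complex_poly_decompose_multiset[of P] by (simp add: M_def)
    then have "smult (inverse (lead_coeff P)) P = smult (inverse (lead_coeff P)) (smult (lead_coeff P) M)" by simp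
    then show ?thesis using P by simp
  qed
  ultimately obtain c where c: "root_poly (proots P) = smult c P" by (metis smult_smult)
  have "1 = c * poly P 0" using poly_root_poly_0[of "proots P"] unfolding c by simp
  then show ?thesis using c assms by simp
qed

text \<open>Splitting \<open>G\<close> into real and imaginary part, the imaginary part times \<open>c\<close> is 0.\<close>
lemma real_quotient:
  assumes "cpoly g = G * cpoly c" "c \<noteq> 0"
  shows "\<exists>h. G = cpoly h"
proof -
  have G: "G = cpoly (map_poly Re G) + smult \<i> (cpoly (map_poly Im G))"
    by (rule poly_eqI) (simp add: coeff_map_poly complex_eq)
  have "cpoly g = cpoly (map_poly Re G * c) + smult \<i> (cpoly (map_poly Im G * c))"
    unfolding assms(1) by (subst G) (simp add: cpoly_mult algebra_simps)
  then have "coeff (map_poly Im G * c) n = 0" for n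
    by (auto simp: poly_eq_iff complex_eq_iff dest: spec[of _ n])
  then have "map_poly Im G * c = 0" by (simp add: poly_eq_iff)
  then have "map_poly Im G = 0" using assms(2) by simp
  then show ?thesis using G by (intro exI[of _ "map_poly Re G"]) simp
qed

definition real_pair :: "complex \<times> complex \<Rightarrow> bool" where
  "real_pair t \<longleftrightarrow> fst t \<in> \<real> \<and> snd t \<in> \<real> \<or> snd t = cnj (fst t)"

text \<open>The polynomial \<open>(1 - z/x)(1 - z/y)\<close> for a pair \<open>(x, y)\<close> with \<open>real_pair (x, y)\<close>, as a real polynomial;
  its top coefficient is written with \<open>pair_prod\<close>, the quantity that the asymptotics refer to.\<close>
definition pair_poly :: "complex \<times> complex \<Rightarrow> real poly" where
  "pair_poly t = [:1, - Re (inverse (fst t) + inverse (snd t)), inverse (pair_prod t):]"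

lemma cpoly_pair_poly:
  assumes "real_pair t"
  shows "cpoly (pair_poly t) = root_poly {#fst t, snd t#}"
proof -
  have "inverse (fst t) + inverse (snd t) \<in> \<real>" "fst t * snd t \<in> \<real>"
    using assms by (auto simp: real_pair_def complex_is_Real_iff)
  then obtain u v where "inverse (fst t) + inverse (snd t) = of_real u" "fst t * snd t = of_real v"
    by (auto elim!: Reals_cases)
  then show ?thesis by (simp add: pair_poly_def root_poly_pair pair_prod_def)
qed

lemma poly_pair_poly:
  assumes "real_pair t"
  shows "complex_of_real (poly (pair_poly t) x) = (1 - of_real x / fst t) * (1 - of_real x / snd t)"
proof -
  have "complex_of_real (poly (pair_poly t) x) = poly (root_poly {#fst t, snd t#}) (of_real x)"
    by (simp only: cpoly_pair_poly[OF assms, symmetric] poly_cpoly_of_real)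
  then show ?thesis by (simp add: root_poly_def divide_inverse algebra_simps)
qed

lemma pair_poly_conj:
  "poly (pair_poly (w, cnj w)) x = (norm (1 - of_real x / w))\<^sup>2"
proof -
  have "complex_of_real (poly (pair_poly (w, cnj w)) x) = (1 - of_real x / w) * cnj (1 - of_real x / w)"
    by (subst poly_pair_poly) (auto simp: real_pair_def)
  then show ?thesis by (simp only: complex_norm_square[symmetric] of_real_eq_iff)
qed

lemma pair_poly_real:
  "poly (pair_poly (of_real x, of_real y)) s = (1 - s / x) * (1 - s / y)"
proof -
  have "complex_of_real (poly (pair_poly (of_real x, of_real y)) s) = complex_of_real ((1 - s / x) * (1 - s / y))"
    by (subst poly_pair_poly) (auto simp: real_pair_def)
  then show ?thesis by (simp only: of_real_eq_iff)
qed

lemma linear_factor_reflection: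
  fixes s u :: real
  assumes "s \<noteq> 0" "u \<noteq> 0"
  shows "(1 - s / u) * (1 - inverse s / u) = (u - s) * (u - inverse s) / u\<^sup>2"
  using assms by (simp add: field_simps power2_eq_square)

lemma disc_rootsD:
  assumes "disc_roots P nm np s"
  shows "\<And>i. 1 \<le> i \<Longrightarrow> i \<le> int np \<Longrightarrow> 0 < s i \<and> s i < 1"
    and "\<And>i. - int nm \<le> i \<Longrightarrow> i \<le> - 1 \<Longrightarrow> - 1 < s i \<and> s i < 0"
    and "\<And>x. \<bar>x\<bar> < 1 \<Longrightarrow> poly P (of_real x) = 0 \<Longrightarrow> \<exists>i\<in>{- int nm..int np} - {0}. x = s i"
    and "strict_mono_on ({- int nm..int np} - {0}) s"
proof -
  have neg: "s ` {- int nm..- 1} \<subseteq> {-1<..<0}" and pos: "s ` {1..int np} \<subseteq> {0<..<1}"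
    and roots: "{z. poly P z = 0 \<and> norm z < 1} = (\<lambda>i. complex_of_real (s i)) ` ({- int nm..int np} - {0})"
    using assms by (auto simp: disc_roots_def)
  show "0 < s i \<and> s i < 1" if "1 \<le> i" "i \<le> int np" for i
  proof -
    have "s i \<in> s ` {1..int np}" using that by (intro imageI) auto
    then show ?thesis using pos by auto
  qed
  show "- 1 < s i \<and> s i < 0" if "- int nm \<le> i" "i \<le> - 1" for i
  proof -
    have "s i \<in> s ` {- int nm..- 1}" using that by (intro imageI) auto
    then show ?thesis using neg by auto
  qed
  show "\<exists>i\<in>{- int nm..int np} - {0}. x = s i" if "\<bar>x\<bar> < 1" "poly P (of_real x) = 0" for x
  proof -
    have "complex_of_real x \<in> {z. poly P z = 0 \<and> norm z < 1}" using that by simp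
    then have "complex_of_real x \<in> (\<lambda>i. complex_of_real (s i)) ` ({- int nm..int np} - {0})"
      using roots by simp
    then show ?thesis by (metis imageE of_real_eq_iff)
  qed
  show "strict_mono_on ({- int nm..int np} - {0}) s" using assms by (simp add: disc_roots_def)
qed

text \<open>Both target points lie outside the interval that contains all \<open>1/s\<close> and, as its end points have modulus
  at least 1, all \<open>s\<close> as well.  Hence \<open>(u - s)(u - 1/s) > 0\<close> for each real target point \<open>u\<close>.\<close>
lemma target_pairD:
  assumes s: "disc_roots P nm np s" and t: "t \<in> target_pairs nm np s"
  shows "real_pair t" "norm (fst t) > 1" "norm (snd t) > 1"
    and "\<And>x. x \<noteq> 0 \<Longrightarrow> \<bar>x\<bar> < 1 \<Longrightarrow> poly P (of_real x) = 0 \<Longrightarrow> poly (pair_poly t) x * poly (pair_poly t) (inverse x) > 0"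
proof -
  note posD = disc_rootsD(1)[OF s] and negD = disc_rootsD(2)[OF s] and mono = disc_rootsD(4)[OF s]
  have up: "upper_end np s \<ge> 1"
  proof (cases "np = 0")
    case False
    then have "0 < s 1" "s 1 < 1" using posD[of 1] by auto
    then show ?thesis using False one_le_inverse[of "s 1"] by (simp add: upper_end_def)
  qed (simp add: upper_end_def)
  have lo: "lower_end nm s \<le> - 1"
  proof (cases "nm = 0")
    case False
    then have "s (-1) < 0" "-1 < s (-1)" using negD[of "-1"] by auto
    then show ?thesis using False one_le_inverse[of "- s (-1)"] by (simp add: lower_end_def)
  qed (simp add: lower_end_def)
  have rootD: "(0 < x \<longrightarrow> inverse x \<le> upper_end np s) \<and> (x < 0 \<longrightarrow> lower_end nm s \<le> inverse x)"
    if x: "\<bar>x\<bar> < 1" "poly P (of_real x) = 0" for x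
  proof -
    obtain i where i: "i \<in> {- int nm..int np} - {0}" "x = s i" using disc_rootsD(3)[OF s x] by blast
    show ?thesis
    proof (cases "i > 0")
      case True
      then have i1: "1 \<in> {- int nm..int np} - {0}" "np \<noteq> 0" using i by auto
      have "s 1 \<le> s i" using strict_mono_on_leD[OF mono i1(1) i(1)] True by simp
      moreover have "s 1 > 0" "s i > 0" using posD[of 1] posD[of i] i True by auto
      ultimately show ?thesis using i i1 by (simp add: upper_end_def le_imp_inverse_le)
    next
      case False
      then have i1: "-1 \<in> {- int nm..int np} - {0}" "nm \<noteq> 0" using i by auto
      have "s i \<le> s (-1)" using strict_mono_on_leD[OF mono i(1) i1(1)] False i by simp
      moreover have "s (-1) < 0" "s i < 0" using negD[of "-1"] negD[of i] i False by auto
      ultimately show ?thesis using i i1 by (simp add: lower_end_def le_imp_inverse_le_neg)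
    qed
  qed
  consider (re) x y where "t = (of_real x, of_real y)" "x \<notin> {lower_end nm s..upper_end np s}" "y \<notin> {lower_end nm s..upper_end np s}"
    | (co) w where "t = (w, cnj w)" "w \<notin> \<real>" "norm w > 1"
    using t by (auto simp: target_pairs_def)
  then have "real_pair t \<and> norm (fst t) > 1 \<and> norm (snd t) > 1 \<and>
    (\<forall>x. x \<noteq> 0 \<longrightarrow> \<bar>x\<bar> < 1 \<longrightarrow> poly P (of_real x) = 0 \<longrightarrow> poly (pair_poly t) x * poly (pair_poly t) (inverse x) > 0)"
  proof cases
    case re
    have fac: "(1 - v / u) * (1 - inverse v / u) > 0"
      if u: "u \<notin> {lower_end nm s..upper_end np s}" and v: "v \<noteq> 0" "\<bar>v\<bar> < 1" "poly P (of_real v) = 0" for u v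
    proof -
      have u0: "u \<noteq> 0" using u up lo by auto
      have iv: "v < 0 \<longrightarrow> inverse v < v" "v > 0 \<longrightarrow> v < inverse v"
        using v by (auto simp: field_simps abs_if power2_eq_square[symmetric] abs_square_less_1 split: if_splits)
      have "(u - v) * (u - inverse v) > 0"
      proof (cases "u > upper_end np s")
        case True
        then have "u > v" "u > inverse v" using up rootD[OF v(2,3)] v(1) iv
          by (auto simp: not_less)
        then show ?thesis by simp
      next
        case False
        then have "u < lower_end nm s" using u by auto
        then have "u < v" "u < inverse v" using lo rootD[OF v(2,3)] v(1) iv
          by (smt (verit) inverse_positive_iff_positive)+
        then show ?thesis by (simp add: mult_neg_neg)
      qed
      then show ?thesis unfolding linear_factor_reflection[OF v(1) u0] using u0 by simp
    qed
    have "poly (pair_poly t) v * poly (pair_poly t) (inverse v) > 0"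
      if v: "v \<noteq> 0" "\<bar>v\<bar> < 1" "poly P (of_real v) = 0" for v
    proof -
      have "poly (pair_poly t) v * poly (pair_poly t) (inverse v)
        = ((1 - v / x) * (1 - inverse v / x)) * ((1 - v / y) * (1 - inverse v / y))"
        unfolding re(1) pair_poly_real by (simp only: mult_ac)
      then show ?thesis using fac[OF re(2) v] fac[OF re(3) v] by simp
    qed
    moreover have "\<bar>x\<bar> > 1" "\<bar>y\<bar> > 1" using re(2,3) up lo by auto
    ultimately show ?thesis using re(1) by (simp add: real_pair_def)
  next
    case co
    have "1 - of_real v / w \<noteq> 0" for v
    proof
      assume "1 - of_real v / w = 0"
      then have "w = of_real v" using co(3) by (auto simp: field_simps)
      then show False using co(2) by simp
    qed
    then have "(norm (1 - of_real v / w))\<^sup>2 > 0" for v by simp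
    then have "poly (pair_poly t) v * poly (pair_poly t) (inverse v) > 0" for v
      unfolding co(1) pair_poly_conj by (intro mult_pos_pos)
    then show ?thesis using co by (simp add: real_pair_def)
  qed
  then show "real_pair t" "norm (fst t) > 1" "norm (snd t) > 1"
    and "\<And>x. x \<noteq> 0 \<Longrightarrow> \<bar>x\<bar> < 1 \<Longrightarrow> poly P (of_real x) = 0 \<Longrightarrow> poly (pair_poly t) x * poly (pair_poly t) (inverse x) > 0"
    by auto
qed

lemma has_jost_roots_degree:
  assumes "has_jost_roots k a b R" "k \<ge> 1"
  shows "degree (jost_poly a b ((k + 1) div 2)) = k" "size R = k"
    "root_poly R = cpoly (jost_poly a b ((k + 1) div 2))" "0 \<notin># R"
proof -
  let ?p = "(k + 1) div 2"
  note J = has_jost_rootsD[OF assms]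
  have p1: "?p \<ge> 1" using assms(2) by simp
  have nz: "perturbation a b k \<noteq> 0" using assms(1) by (auto simp: has_jost_roots_def pert_class_def)
  show d: "degree (jost_poly a b ?p) = k"
  proof (cases "even k")
    case True
    then have "k = 2 * ?p" by simp
    moreover have "a ?p \<noteq> 1" using nz True by (simp add: perturbation_def)
    ultimately show ?thesis using degree_jost_poly_even[of ?p a b] J(2)[OF p1] p1 by simp
  next
    case False
    then have "k = 2 * ?p - 1" by (auto elim: oddE)
    moreover have "b ?p \<noteq> 0" using nz False by (simp add: perturbation_def)
    ultimately show ?thesis using degree_jost_poly_odd[of ?p a b] J(5) False p1 by simp
  qed
  show "size R = k" using size_proots_complex[of "cpoly (jost_poly a b ?p)"] d J(6) by simp
  have "poly (cpoly (jost_poly a b ?p)) (of_real 0) = 1" unfolding poly_cpoly_of_real by simp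
  then have p0: "poly (cpoly (jost_poly a b ?p)) 0 = 1" by simp
  then show "root_poly R = cpoly (jost_poly a b ?p)" using root_poly_proots[OF p0] J(6) by simp
  have "cpoly (jost_poly a b ?p) \<noteq> 0" using p0 by auto
  then show "0 \<notin># R" using p0 J(6) by auto
qed

text \<open>For a real pair \<open>(u, s\<^sub>j)\<close> and a root \<open>x = s\<^sub>i > 0\<close> the sign is that of
  \<open>(s\<^sub>j - x) (1/x - u)\<close>, since \<open>x < 1 \<le> u\<close> and \<open>s\<^sub>j < 1 < 1/x\<close>.  For \<open>i < j\<close> both factors are positive by
  \<open>u < 1/s\<^sub>j\<^sub>-\<^sub>1\<close>, for \<open>i > j\<close> both are negative by \<open>u > 1/s\<^sub>j\<^sub>+\<^sub>1\<close>.\<close>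
lemma removable_pair:
  assumes s: "disc_roots P nm np s" and r: "norm r \<ge> 1"
    and pair: "(r \<notin> \<real> \<and> ss = cnj r) \<or>
         (\<exists>x j. r = complex_of_real x \<and> ss = complex_of_real (s j) \<and>
            ((2 \<le> j \<and> j \<le> int np - 1 \<and> inverse (s (j + 1)) < x \<and> x < inverse (s (j - 1))) \<or>
             (2 \<le> np \<and> j = int np \<and> 1 < x \<and> x < inverse (s (j - 1)))))"
  shows "real_pair (r, ss)" "r \<noteq> ss" "ss = cnj r \<or> poly P ss = 0"
    and "\<And>x. x \<noteq> 0 \<Longrightarrow> \<bar>x\<bar> < 1 \<Longrightarrow> poly P (of_real x) = 0 \<Longrightarrow>
      poly (pair_poly (r, ss)) x * poly (pair_poly (r, ss)) (inverse x) \<ge> 0"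
proof -
  note posD = disc_rootsD(1)[OF s] and negD = disc_rootsD(2)[OF s] and mono = disc_rootsD(4)[OF s]
  consider (conj) "r \<notin> \<real>" "ss = cnj r"
    | (re) u j where "r = of_real u" "ss = of_real (s j)" "2 \<le> j" "j \<le> int np" "u < inverse (s (j - 1))"
        "j = int np \<and> 1 < u \<or> j < int np \<and> inverse (s (j + 1)) < u"
    using pair by fastforce
  then have "real_pair (r, ss) \<and> r \<noteq> ss \<and> (ss = cnj r \<or> poly P ss = 0) \<and>
    (\<forall>x. x \<noteq> 0 \<longrightarrow> \<bar>x\<bar> < 1 \<longrightarrow> poly P (of_real x) = 0 \<longrightarrow>
      poly (pair_poly (r, ss)) x * poly (pair_poly (r, ss)) (inverse x) \<ge> 0)"
  proof cases
    case conj
    have "r \<noteq> cnj r" using conj(1) by (metis Reals_cnj_iff)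
    then show ?thesis unfolding conj(2) pair_poly_conj by (simp add: real_pair_def)
  next
    case re
    have j: "0 < s j" "s j < 1" "0 < s (j - 1)" "s (j - 1) < 1" using posD[of j] posD[of "j - 1"] re by auto
    have u1: "1 \<le> u"
    proof -
      have "\<bar>u\<bar> \<ge> 1" using r re(1) by simp
      moreover have "u > 0"
        using re(6)
      proof
        assume "j < int np \<and> inverse (s (j + 1)) < u"
        moreover from this have "inverse (s (j + 1)) > 0" using posD[of "j + 1"] re(3) by simp
        ultimately show ?thesis by linarith
      qed simp
      ultimately show ?thesis by simp
    qed
    have sj: "complex_of_real (s j) \<in> {z. poly P z = 0 \<and> norm z < 1}"
      using s re(3,4) unfolding disc_roots_def by auto
    have "poly (pair_poly (r, ss)) x * poly (pair_poly (r, ss)) (inverse x) \<ge> 0"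
      if x: "x \<noteq> 0" "\<bar>x\<bar> < 1" "poly P (of_real x) = 0" for x
    proof -
      have key: "(u - x) * (u - inverse x) * ((s j - x) * (s j - inverse x)) \<ge> 0"
      proof -
        obtain i where i: "i \<in> {- int nm..int np} - {0}" "x = s i" using disc_rootsD(3)[OF s x(2,3)] by blast
        show ?thesis
        proof (cases "i > 0")
          case False
          then have "x < 0" using i negD[of i] by auto
          moreover from this have "inverse x < 0" by simp
          ultimately have "u - x > 0" "u - inverse x > 0" "s j - x > 0" "s j - inverse x > 0"
            using u1 j by linarith+
          then show ?thesis by simp
        next
          case True
          then have x0: "0 < x" "x < 1" using i posD[of i] by auto
          then have ix: "1 < inverse x" by (rule one_less_inverse)
          have a: "u - x > 0" "s j - inverse x < 0" using u1 x0 ix j by auto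
          have "(u - inverse x) * (s j - x) \<le> 0"
          proof (cases i j rule: linorder_cases)
            case less
            then have "s i \<le> s (j - 1)" using strict_mono_on_leD[OF mono i(1), of "j - 1"] re(3,4) by auto
            then have "inverse (s (j - 1)) \<le> inverse x" using x0 i by (simp add: le_imp_inverse_le)
            then have "u - inverse x < 0" using re(5) by simp
            moreover have "s j - x > 0" using strict_mono_onD[OF mono i(1), of j] less re(3,4) i by auto
            ultimately show ?thesis by (simp add: mult_neg_pos less_imp_le)
          next
            case equal
            then show ?thesis using i by simp
          next
            case greater
            then have jn: "j \<noteq> int np" using i by auto
            then have "s (j + 1) \<le> s i" using strict_mono_on_leD[OF mono _ i(1), of "j + 1"] greater i re(3) by auto
            moreover have "0 < s (j + 1)" using posD[of "j + 1"] re(3,4) jn by auto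
            ultimately have "inverse x \<le> inverse (s (j + 1))" using i by (simp add: le_imp_inverse_le)
            then have "u - inverse x > 0" using re(6) jn by simp
            moreover have "s j - x < 0" using strict_mono_onD[OF mono _ i(1), of j] greater re(3,4) i by auto
            ultimately show ?thesis by (simp add: mult_pos_neg less_imp_le)
          qed
          then have "((u - x) * (s j - inverse x)) * ((u - inverse x) * (s j - x)) \<ge> 0"
            using mult_pos_neg[OF a] by (intro mult_nonpos_nonpos) auto
          then show ?thesis by (simp only: mult_ac)
        qed
      qed
      have "poly (pair_poly (r, ss)) x * poly (pair_poly (r, ss)) (inverse x)
        = ((1 - x / u) * (1 - inverse x / u)) * ((1 - x / s j) * (1 - inverse x / s j))"
        unfolding re(1,2) pair_poly_real by (simp only: mult_ac)
      also have "\<dots> = (u - x) * (u - inverse x) * ((s j - x) * (s j - inverse x)) / (u\<^sup>2 * (s j)\<^sup>2)"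
        using linear_factor_reflection[OF x(1), of u] linear_factor_reflection[OF x(1), of "s j"] u1 j by simp
      also have "\<dots> \<ge> 0" using key by (intro divide_nonneg_nonneg) auto
      finally show ?thesis .
    qed
    then show ?thesis using re(1,2) u1 j sj by (simp add: real_pair_def)
  qed
  then show "real_pair (r, ss)" "r \<noteq> ss" "ss = cnj r \<or> poly P ss = 0"
    and "\<And>x. x \<noteq> 0 \<Longrightarrow> \<bar>x\<bar> < 1 \<Longrightarrow> poly P (of_real x) = 0 \<Longrightarrow>
      poly (pair_poly (r, ss)) x * poly (pair_poly (r, ss)) (inverse x) \<ge> 0"
    by auto
qed

section \<open>Dependence of the coefficients on an added pair of roots\<close>

lemma coeff_orth_poly_sublead:
  "coeff (orth_poly a b (Suc n)) n = coeff (pCons 0 (orth_poly a b n)) n - b (Suc n)"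
proof (cases n)
  case (Suc m)
  then show ?thesis by (simp add: coeff_eq_0)
qed simp

text \<open>Multiplication by \<open>1 - \<sigma> z + \<mu> z\<^sup>2\<close> acts linearly on the two components: divide by \<open>z\<close>, use
  \<open>1/z = w - z\<close> and \<open>z\<^sup>2 = z w - 1\<close>, and compare components.\<close>
lemma jost_poly_mult_quadratic:
  assumes "jost_poly a b (Suc (Suc m)) = [:1, - \<sigma>, \<mu>:] * jost_poly ao bo (Suc m)"
  shows "orth_poly a b (Suc (Suc m)) = [:- \<sigma>, 1:] * orth_poly ao bo (Suc m)
      - smult (1 - \<mu>) (smult ((ao (Suc m))\<^sup>2) (orth_poly ao bo m))"
    and "smult ((a (Suc (Suc m)))\<^sup>2) (orth_poly a b (Suc m)) =
      smult (1 - \<mu>) (orth_poly ao bo (Suc m)) + [:- \<sigma>, \<mu>:] * smult ((ao (Suc m))\<^sup>2) (orth_poly ao bo m)"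
proof -
  define A where "A = orth_poly ao bo (Suc m)"
  define B where "B = smult ((ao (Suc m))\<^sup>2) (orth_poly ao bo m)"
  define A' where "A' = [:- \<sigma>, 1:] * A - smult (1 - \<mu>) B"
  define B' where "B' = smult (1 - \<mu>) A + [:- \<sigma>, \<mu>:] * B"
  define C where "C = orth_poly a b (Suc (Suc m))"
  define D where "D = smult ((a (Suc (Suc m)))\<^sup>2) (orth_poly a b (Suc m))"
  have "poly (cpoly C) (z + inverse z) - z * poly (cpoly D) (z + inverse z) =
    poly (cpoly A') (z + inverse z) - z * poly (cpoly B') (z + inverse z)" if z: "z \<noteq> 0" for z
  proof -
    let ?w = "z + inverse z"
    have "z ^ Suc (Suc m) * (poly (cpoly C) ?w - z * poly (cpoly D) ?w) = poly (cpoly (jost_poly a b (Suc (Suc m)))) z"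
      using poly_jost_poly[OF z, of "Suc (Suc m)" a b] by (simp add: C_def D_def cpoly_smult)
    also have "\<dots> = (1 - \<sigma> * z + \<mu> * z * z) * (z ^ Suc m * (poly (cpoly A) ?w - z * poly (cpoly B) ?w))"
    proof -
      have "poly (cpoly (jost_poly ao bo (Suc m))) z = z ^ Suc m * (poly (cpoly A) ?w - z * poly (cpoly B) ?w)"
        using poly_jost_poly[OF z, of "Suc m" ao bo] by (simp add: A_def B_def cpoly_smult)
      moreover have "poly (cpoly [:1, - \<sigma>, \<mu>:]) z = 1 - \<sigma> * z + \<mu> * z * z"
        by (simp add: algebra_simps)
      ultimately show ?thesis unfolding assms cpoly_mult poly_mult by simp
    qed
    also have "\<dots> = z ^ Suc (Suc m) * ((inverse z - \<sigma> + \<mu> * z) * (poly (cpoly A) ?w - z * poly (cpoly B) ?w))"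
    proof -
      have "1 - \<sigma> * z + \<mu> * z * z = z * (inverse z - \<sigma> + \<mu> * z)" using z by (simp add: algebra_simps)
      then show ?thesis by (simp only: power_Suc mult_ac)
    qed
    also have "(inverse z - \<sigma> + \<mu> * z) * (poly (cpoly A) ?w - z * poly (cpoly B) ?w) =
      poly (cpoly A') ?w - z * poly (cpoly B') ?w"
    proof -
      have *: "(i - \<sigma>' + \<mu>' * z) * (x - z * y) =
        ((z + i) * x - \<sigma>' * x - (1 - \<mu>') * y) - z * ((1 - \<mu>') * x + (\<mu>' * (z + i) - \<sigma>') * y)"
        if "z * i = 1" for i x y \<sigma>' \<mu>' :: complex using that by algebra
      show ?thesis
        unfolding *[OF right_inverse[OF z]] by (simp add: A'_def B'_def cpoly_hom algebra_simps)
    qed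
    finally show ?thesis using z by simp
  qed
  from joukowski_decomposition_unique[of "cpoly C" "cpoly D" "cpoly A'" "cpoly B'", OF this]
  have "C = A'" "D = B'" by auto
  then show "orth_poly a b (Suc (Suc m)) = [:- \<sigma>, 1:] * orth_poly ao bo (Suc m)
      - smult (1 - \<mu>) (smult ((ao (Suc m))\<^sup>2) (orth_poly ao bo m))"
    and "smult ((a (Suc (Suc m)))\<^sup>2) (orth_poly a b (Suc m)) =
      smult (1 - \<mu>) (orth_poly ao bo (Suc m)) + [:- \<sigma>, \<mu>:] * smult ((ao (Suc m))\<^sup>2) (orth_poly ao bo m)"
    unfolding A_def B_def A'_def B'_def C_def D_def by auto
qed

lemma last_coeff_a:
  assumes "jost_poly a b (Suc (Suc m)) = [:1, - \<sigma>, \<mu>:] * jost_poly ao bo (Suc m)"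
  shows "(a (Suc (Suc m)))\<^sup>2 = 1 - (1 - (ao (Suc m))\<^sup>2) * \<mu>"
proof -
  have "coeff (smult ((a (Suc (Suc m)))\<^sup>2) (orth_poly a b (Suc m))) (Suc m) =
    coeff (smult (1 - \<mu>) (orth_poly ao bo (Suc m)) + [:- \<sigma>, \<mu>:] * smult ((ao (Suc m))\<^sup>2) (orth_poly ao bo m)) (Suc m)"
    by (simp only: jost_poly_mult_quadratic(2)[OF assms])
  then show ?thesis by (simp add: coeff_eq_0 algebra_simps del: orth_poly.simps)
qed

lemma last_coeff_b:
  assumes J: "jost_poly a b (Suc (Suc m)) = [:1, - \<sigma>, \<mu>:] * jost_poly ao bo (Suc m)"
    and 1: "a (Suc (Suc m)) = 1" "ao (Suc m) = 1"
  shows "b (Suc (Suc m)) = bo (Suc m) * \<mu>"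
proof -
  have e1: "coeff (orth_poly a b (Suc (Suc m))) (Suc m) = coeff (orth_poly a b (Suc m)) m - b (Suc (Suc m))"
    using coeff_orth_poly_sublead[of a b "Suc m"] by simp
  have e2: "coeff (orth_poly a b (Suc (Suc m))) (Suc m) = coeff (orth_poly ao bo (Suc m)) m - \<sigma>"
    unfolding jost_poly_mult_quadratic(1)[OF J] by (simp add: coeff_eq_0 del: orth_poly.simps)
  have "orth_poly a b (Suc m) = smult (1 - \<mu>) (orth_poly ao bo (Suc m)) + [:- \<sigma>, \<mu>:] * orth_poly ao bo m"
    using jost_poly_mult_quadratic(2)[OF J] unfolding 1 by simp
  then have e3: "coeff (orth_poly a b (Suc m)) m = (1 - \<mu>) * coeff (orth_poly ao bo (Suc m)) m - \<sigma> + \<mu> * coeff (pCons 0 (orth_poly ao bo m)) m"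
    by (simp add: coeff_pCons split: nat.splits del: orth_poly.simps)
  show ?thesis using e1 e2 e3 coeff_orth_poly_sublead[of ao bo m] by (simp add: algebra_simps)
qed

text \<open>Continuity of the descent: \<open>b\<^sub>n\<^sub>+\<^sub>2\<close> is a difference of coefficients of two consecutive orthogonal
  polynomials, then \<open>a\<^sub>n\<^sub>+\<^sub>1\<^sup>2 \<pi>\<^sub>n\<close> is given by the recurrence, and its leading coefficient is \<open>a\<^sub>n\<^sub>+\<^sub>1\<^sup>2\<close>,
  which stays away from 0.\<close>
lemma orth_poly_coeffs_tendsto:
  fixes \<alpha> \<beta> :: "'t \<Rightarrow> nat \<Rightarrow> real"
  assumes pos: "\<And>i. i \<ge> 1 \<Longrightarrow> ao i > 0"
    and post: "eventually (\<lambda>t. \<forall>i\<ge>1. \<alpha> t i > 0) F"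
    and lim1: "\<And>i. ((\<lambda>t. coeff (orth_poly (\<alpha> t) (\<beta> t) (Suc n)) i) \<longlongrightarrow> coeff (orth_poly ao bo (Suc n)) i) F"
    and lim0: "\<And>i. ((\<lambda>t. coeff (orth_poly (\<alpha> t) (\<beta> t) n) i) \<longlongrightarrow> coeff (orth_poly ao bo n) i) F"
  shows "(\<forall>j. 1 \<le> j \<and> j \<le> n \<longrightarrow> ((\<lambda>t. \<alpha> t j) \<longlongrightarrow> ao j) F) \<and>
    (\<forall>j. 1 \<le> j \<and> j \<le> Suc n \<longrightarrow> ((\<lambda>t. \<beta> t j) \<longlongrightarrow> bo j) F)"
  using lim1 lim0
proof (induction n)
  case 0
  have "((\<lambda>t. - coeff (orth_poly (\<alpha> t) (\<beta> t) (Suc 0)) 0) \<longlongrightarrow> - coeff (orth_poly ao bo (Suc 0)) 0) F"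
    by (intro tendsto_intros 0)
  then have "((\<lambda>t. \<beta> t (Suc 0)) \<longlongrightarrow> bo (Suc 0)) F" by simp
  moreover have "j = Suc 0" if "1 \<le> j" "j \<le> Suc 0" for j using that by simp
  ultimately show ?case by auto
next
  case (Suc n)
  note l2 = Suc.prems(1) and l1 = Suc.prems(2)
  have beq: "\<beta> t (Suc (Suc n)) = coeff (orth_poly (\<alpha> t) (\<beta> t) (Suc n)) n - coeff (orth_poly (\<alpha> t) (\<beta> t) (Suc (Suc n))) (Suc n)" for t
    using coeff_orth_poly_sublead[of "\<alpha> t" "\<beta> t" "Suc n"] by simp
  have beq': "bo (Suc (Suc n)) = coeff (orth_poly ao bo (Suc n)) n - coeff (orth_poly ao bo (Suc (Suc n))) (Suc n)"
    using coeff_orth_poly_sublead[of ao bo "Suc n"] by simp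
  have bl: "((\<lambda>t. \<beta> t (Suc (Suc n))) \<longlongrightarrow> bo (Suc (Suc n))) F"
    unfolding beq beq' by (intro tendsto_intros l1 l2)
  have ceq: "(a (Suc n))\<^sup>2 * coeff (orth_poly a b n) i =
    coeff (pCons 0 (orth_poly a b (Suc n))) i - b (Suc (Suc n)) * coeff (orth_poly a b (Suc n)) i
      - coeff (orth_poly a b (Suc (Suc n))) i" for a b i
    by (simp add: algebra_simps)
  have l1': "((\<lambda>t. coeff (pCons 0 (orth_poly (\<alpha> t) (\<beta> t) (Suc n))) i) \<longlongrightarrow> coeff (pCons 0 (orth_poly ao bo (Suc n))) i) F" for i
    by (cases i) (simp_all only: coeff_pCons_0 coeff_pCons_Suc tendsto_const l1)
  have prod: "((\<lambda>t. (\<alpha> t (Suc n))\<^sup>2 * coeff (orth_poly (\<alpha> t) (\<beta> t) n) i) \<longlongrightarrow> (ao (Suc n))\<^sup>2 * coeff (orth_poly ao bo n) i) F" for i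
    unfolding ceq by (intro tendsto_intros bl l1 l1' l2)
  have a2: "((\<lambda>t. (\<alpha> t (Suc n))\<^sup>2) \<longlongrightarrow> (ao (Suc n))\<^sup>2) F" using prod[of n] by simp
  have ao0: "(ao (Suc n))\<^sup>2 \<noteq> 0" using pos[of "Suc n"] by simp
  have l0: "((\<lambda>t. coeff (orth_poly (\<alpha> t) (\<beta> t) n) i) \<longlongrightarrow> coeff (orth_poly ao bo n) i) F" for i
  proof -
    have "((\<lambda>t. ((\<alpha> t (Suc n))\<^sup>2 * coeff (orth_poly (\<alpha> t) (\<beta> t) n) i) / (\<alpha> t (Suc n))\<^sup>2) \<longlongrightarrow>
      ((ao (Suc n))\<^sup>2 * coeff (orth_poly ao bo n) i) / (ao (Suc n))\<^sup>2) F"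
      by (intro tendsto_divide prod a2 ao0)
    then have "((\<lambda>t. ((\<alpha> t (Suc n))\<^sup>2 * coeff (orth_poly (\<alpha> t) (\<beta> t) n) i) / (\<alpha> t (Suc n))\<^sup>2) \<longlongrightarrow>
      coeff (orth_poly ao bo n) i) F" using ao0 by simp
    moreover have "eventually (\<lambda>t. ((\<alpha> t (Suc n))\<^sup>2 * coeff (orth_poly (\<alpha> t) (\<beta> t) n) i) / (\<alpha> t (Suc n))\<^sup>2 =
       coeff (orth_poly (\<alpha> t) (\<beta> t) n) i) F"
      using post
    proof (rule eventually_mono)
      fix t assume "\<forall>i\<ge>1. \<alpha> t i > 0"
      then have "\<alpha> t (Suc n) \<noteq> 0" by (metis le_add1 less_irrefl plus_1_eq_Suc)
      then show "((\<alpha> t (Suc n))\<^sup>2 * coeff (orth_poly (\<alpha> t) (\<beta> t) n) i) / (\<alpha> t (Suc n))\<^sup>2 =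
       coeff (orth_poly (\<alpha> t) (\<beta> t) n) i" by simp
    qed
    ultimately show ?thesis by (rule Lim_transform_eventually)
  qed
  have al: "((\<lambda>t. \<alpha> t (Suc n)) \<longlongrightarrow> ao (Suc n)) F"
  proof -
    have "((\<lambda>t. sqrt ((\<alpha> t (Suc n))\<^sup>2)) \<longlongrightarrow> sqrt ((ao (Suc n))\<^sup>2)) F"
      by (intro tendsto_intros a2)
    then have "((\<lambda>t. sqrt ((\<alpha> t (Suc n))\<^sup>2)) \<longlongrightarrow> ao (Suc n)) F" using pos[of "Suc n"] by simp
    moreover have "eventually (\<lambda>t. sqrt ((\<alpha> t (Suc n))\<^sup>2) = \<alpha> t (Suc n)) F"
      using post
    proof (rule eventually_mono)
      fix t assume "\<forall>i\<ge>1. \<alpha> t i > 0"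
      then have "\<alpha> t (Suc n) > 0" by simp
      then show "sqrt ((\<alpha> t (Suc n))\<^sup>2) = \<alpha> t (Suc n)" by simp
    qed
    ultimately show ?thesis by (rule Lim_transform_eventually)
  qed
  show ?case using Suc.IH[OF l1 l0] al bl by (auto simp: le_Suc_eq)
qed

lemma pair_prod_tendsto:
  "((\<lambda>t. inverse (pair_prod t)) \<longlongrightarrow> 0) (prod_at_infinity T)"
proof -
  have "filterlim (\<lambda>t. \<bar>pair_prod t\<bar>) at_top (prod_at_infinity T)"
    unfolding prod_at_infinity_def by (rule filterlim_mono[OF filterlim_filtercomap order_refl inf_le1])
  then have "((\<lambda>t. inverse \<bar>pair_prod t\<bar>) \<longlongrightarrow> 0) (prod_at_infinity T)"
    by (rule tendsto_inverse_0_at_top)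
  then have "((\<lambda>t. \<bar>inverse (pair_prod t)\<bar>) \<longlongrightarrow> 0) (prod_at_infinity T)"
    by simp
  then show ?thesis by (rule tendsto_rabs_zero_cancel)
qed

lemma both_at_infinity_tendsto:
  "((\<lambda>t. inverse (fst t)) \<longlongrightarrow> 0) (both_at_infinity T)" "((\<lambda>t. inverse (snd t)) \<longlongrightarrow> 0) (both_at_infinity T)"
proof -
  have min: "filterlim (\<lambda>t. min (norm (fst t)) (norm (snd t))) at_top (both_at_infinity T)"
    unfolding both_at_infinity_def by (rule filterlim_mono[OF filterlim_filtercomap order_refl inf_le1])
  have 1: "filterlim (\<lambda>t. norm (fst t)) at_top (both_at_infinity T)"
    by (rule filterlim_at_top_mono[OF min]) auto
  have 2: "filterlim (\<lambda>t. norm (snd t)) at_top (both_at_infinity T)"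
    by (rule filterlim_at_top_mono[OF min]) auto
  show "((\<lambda>t. inverse (fst t)) \<longlongrightarrow> 0) (both_at_infinity T)"
    using 1 by (intro filterlim_compose[OF tendsto_inverse_0]) (simp add: filterlim_norm_at_top_imp_at_infinity)
  show "((\<lambda>t. inverse (snd t)) \<longlongrightarrow> 0) (both_at_infinity T)"
    using 2 by (intro filterlim_compose[OF tendsto_inverse_0]) (simp add: filterlim_norm_at_top_imp_at_infinity)
qed

text \<open>From \<open>\<alpha>\<^sup>2 = 1 - C/\<aa>\<close> one has \<open>\<aa> (1 - \<alpha>) = C / (1 + \<alpha>)\<close>, which tends to \<open>C/2\<close>.\<close>
lemma last_a_asymptotics:
  fixes \<alpha> :: "complex \<times> complex \<Rightarrow> real"
  assumes pos: "\<And>t. t \<in> T \<Longrightarrow> \<alpha> t > 0" "\<And>t. t \<in> T \<Longrightarrow> pair_prod t \<noteq> 0"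
    and sq: "\<And>t. t \<in> T \<Longrightarrow> (\<alpha> t)\<^sup>2 = 1 - C * inverse (pair_prod t)"
  shows "\<exists>\<epsilon>. (\<epsilon> \<longlongrightarrow> 0) (prod_at_infinity T) \<and> (\<forall>t\<in>T. \<alpha> t = 1 - (C + \<epsilon> t) / (2 * pair_prod t))"
proof (intro exI conjI ballI)
  define \<epsilon> where "\<epsilon> t = 2 * pair_prod t * (1 - \<alpha> t) - C" for t
  show "\<alpha> t = 1 - (C + \<epsilon> t) / (2 * pair_prod t)" if "t \<in> T" for t
    using pos(2)[OF that] by (simp add: \<epsilon>_def)
  have "((\<lambda>t. 2 * C / (1 + sqrt (1 - C * inverse (pair_prod t))) - C) \<longlongrightarrow> 2 * C / (1 + sqrt (1 - C * 0)) - C) (prod_at_infinity T)"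
    by (intro tendsto_intros pair_prod_tendsto) simp
  then have "((\<lambda>t. 2 * C / (1 + sqrt (1 - C * inverse (pair_prod t))) - C) \<longlongrightarrow> 0) (prod_at_infinity T)"
    by simp
  moreover have "eventually (\<lambda>t. 2 * C / (1 + sqrt (1 - C * inverse (pair_prod t))) - C = \<epsilon> t) (prod_at_infinity T)"
    unfolding prod_at_infinity_def eventually_inf_principal
  proof (rule always_eventually, intro allI impI)
    fix t assume t: "t \<in> T"
    have s: "sqrt (1 - C * inverse (pair_prod t)) = \<alpha> t"
      using sq[OF t] pos(1)[OF t] by (simp add: real_sqrt_unique)
    have "C = pair_prod t * (1 - (\<alpha> t)\<^sup>2)" using sq[OF t] pos(2)[OF t] by simp
    then have "C = pair_prod t * (1 - \<alpha> t) * (1 + \<alpha> t)" by (simp add: power2_eq_square algebra_simps)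
    then have "2 * C / (1 + \<alpha> t) = 2 * pair_prod t * (1 - \<alpha> t)"
      using pos(1)[OF t] by (simp add: field_simps)
    then show "2 * C / (1 + sqrt (1 - C * inverse (pair_prod t))) - C = \<epsilon> t"
      unfolding s \<epsilon>_def by simp
  qed
  ultimately show "(\<epsilon> \<longlongrightarrow> 0) (prod_at_infinity T)" by (rule Lim_transform_eventually)
qed

text \<open>The limiting operator is regarded as one with \<open>m + 2\<close> coefficients, the last ones being trivial; its
  polynomial \<open>\<pi>\<^sub>m\<^sub>+\<^sub>2\<close> is then \<open>x A - B\<close>, which is the limit of the first identity in
  \<open>jost_poly_mult_quadratic\<close>.\<close>
lemma jacobi_coeffs_tendsto:
  fixes \<alpha> \<beta> :: "'t \<Rightarrow> nat \<Rightarrow> real" and \<sigma> \<mu> :: "'t \<Rightarrow> real"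
  assumes opos: "\<And>i. i \<ge> 1 \<Longrightarrow> ao i > 0" and otriv: "ao (Suc (Suc m)) = 1" "bo (Suc (Suc m)) = 0"
    and J: "eventually (\<lambda>t. (\<forall>i\<ge>1. \<alpha> t i > 0) \<and>
      jost_poly (\<alpha> t) (\<beta> t) (Suc (Suc m)) = [:1, - \<sigma> t, \<mu> t:] * jost_poly ao bo (Suc m)) F"
    and lim: "(\<sigma> \<longlongrightarrow> 0) F" "(\<mu> \<longlongrightarrow> 0) F"
    and j: "1 \<le> j" "j \<le> Suc (Suc m)"
  shows "((\<lambda>t. \<alpha> t j) \<longlongrightarrow> ao j) F" "((\<lambda>t. \<beta> t j) \<longlongrightarrow> bo j) F"
proof -
  let ?A = "orth_poly ao bo (Suc m)" and ?B = "smult ((ao (Suc m))\<^sup>2) (orth_poly ao bo m)"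
  let ?C = "1 - (ao (Suc m))\<^sup>2"
  let ?p = "Suc (Suc m)"
  have post: "eventually (\<lambda>t. \<forall>i\<ge>1. \<alpha> t i > 0) F" using J by (rule eventually_mono) auto
  have sq: "((\<lambda>t. 1 - ?C * \<mu> t) \<longlongrightarrow> 1) F"
    using tendsto_diff[OF tendsto_const[of 1] tendsto_mult[OF tendsto_const[of ?C] lim(2)]] by simp
  have lim1: "((\<lambda>t. coeff (orth_poly (\<alpha> t) (\<beta> t) ?p) i) \<longlongrightarrow> coeff (orth_poly ao bo ?p) i) F" for i
  proof (rule Lim_transform_eventually)
    have "((\<lambda>t. coeff (pCons 0 ?A) i - \<sigma> t * coeff ?A i - (1 - \<mu> t) * coeff ?B i) \<longlongrightarrow>
       coeff (pCons 0 ?A) i - 0 * coeff ?A i - (1 - 0) * coeff ?B i) F"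
      by (intro tendsto_intros lim)
    then show "((\<lambda>t. coeff (pCons 0 ?A) i - \<sigma> t * coeff ?A i - (1 - \<mu> t) * coeff ?B i) \<longlongrightarrow>
       coeff (orth_poly ao bo ?p) i) F" by (simp add: otriv)
    show "eventually (\<lambda>t. coeff (pCons 0 ?A) i - \<sigma> t * coeff ?A i - (1 - \<mu> t) * coeff ?B i
      = coeff (orth_poly (\<alpha> t) (\<beta> t) ?p) i) F"
      using J by (rule eventually_mono) (simp add: jost_poly_mult_quadratic(1) del: orth_poly.simps)
  qed
  have lim0: "((\<lambda>t. coeff (orth_poly (\<alpha> t) (\<beta> t) (Suc m)) i) \<longlongrightarrow> coeff (orth_poly ao bo (Suc m)) i) F" for i
  proof (rule Lim_transform_eventually)
    have "((\<lambda>t. ((1 - \<mu> t) * coeff ?A i + (\<mu> t * coeff (pCons 0 ?B) i - \<sigma> t * coeff ?B i)) / (1 - ?C * \<mu> t)) \<longlongrightarrow>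
       ((1 - 0) * coeff ?A i + (0 * coeff (pCons 0 ?B) i - 0 * coeff ?B i)) / 1) F"
      by (intro tendsto_intros lim sq) simp
    then show "((\<lambda>t. ((1 - \<mu> t) * coeff ?A i + (\<mu> t * coeff (pCons 0 ?B) i - \<sigma> t * coeff ?B i)) / (1 - ?C * \<mu> t)) \<longlongrightarrow>
       coeff (orth_poly ao bo (Suc m)) i) F" by simp
    show "eventually (\<lambda>t. ((1 - \<mu> t) * coeff ?A i + (\<mu> t * coeff (pCons 0 ?B) i - \<sigma> t * coeff ?B i)) / (1 - ?C * \<mu> t)
      = coeff (orth_poly (\<alpha> t) (\<beta> t) (Suc m)) i) F"
      using J
    proof (rule eventually_mono)
      fix t assume t: "(\<forall>i\<ge>1. \<alpha> t i > 0) \<and>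
        jost_poly (\<alpha> t) (\<beta> t) (Suc (Suc m)) = [:1, - \<sigma> t, \<mu> t:] * jost_poly ao bo (Suc m)"
      then have J': "jost_poly (\<alpha> t) (\<beta> t) (Suc (Suc m)) = [:1, - \<sigma> t, \<mu> t:] * jost_poly ao bo (Suc m)" by blast
      have a0: "(\<alpha> t ?p)\<^sup>2 \<noteq> 0" using t by (metis le_add1 less_irrefl plus_1_eq_Suc power_not_zero)
      have "coeff ([:- \<sigma> t, \<mu> t:] * ?B) i = \<mu> t * coeff (pCons 0 ?B) i - \<sigma> t * coeff ?B i"
        by (cases i) (simp_all add: algebra_simps del: orth_poly.simps)
      then have e: "(\<alpha> t ?p)\<^sup>2 * coeff (orth_poly (\<alpha> t) (\<beta> t) (Suc m)) i =
        (1 - \<mu> t) * coeff ?A i + (\<mu> t * coeff (pCons 0 ?B) i - \<sigma> t * coeff ?B i)"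
        using arg_cong[OF jost_poly_mult_quadratic(2)[OF J'], of "\<lambda>q. coeff q i"]
        by (simp only: coeff_smult coeff_add)
      show "((1 - \<mu> t) * coeff ?A i + (\<mu> t * coeff (pCons 0 ?B) i - \<sigma> t * coeff ?B i)) / (1 - ?C * \<mu> t)
        = coeff (orth_poly (\<alpha> t) (\<beta> t) (Suc m)) i"
        unfolding e[symmetric] last_coeff_a[OF J', symmetric] using a0 by simp
    qed
  qed
  note L = orth_poly_coeffs_tendsto[of ao \<alpha> F \<beta> "Suc m" bo, OF opos post lim1 lim0]
  have "((\<lambda>t. \<alpha> t ?p) \<longlongrightarrow> ao ?p) F"
  proof (rule Lim_transform_eventually)
    show "((\<lambda>t. sqrt (1 - ?C * \<mu> t)) \<longlongrightarrow> ao ?p) F"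
      using tendsto_real_sqrt[OF sq] by (simp add: otriv)
    show "eventually (\<lambda>t. sqrt (1 - ?C * \<mu> t) = \<alpha> t ?p) F"
      using J
    proof (rule eventually_mono)
      fix t assume t: "(\<forall>i\<ge>1. \<alpha> t i > 0) \<and>
        jost_poly (\<alpha> t) (\<beta> t) (Suc (Suc m)) = [:1, - \<sigma> t, \<mu> t:] * jost_poly ao bo (Suc m)"
      then have "\<alpha> t ?p > 0" by simp
      then show "sqrt (1 - ?C * \<mu> t) = \<alpha> t ?p"
        using last_coeff_a[OF conjunct2[OF t]] by (simp add: real_sqrt_unique)
    qed
  qed
  then show "((\<lambda>t. \<alpha> t j) \<longlongrightarrow> ao j) F" using L j by (cases "j = ?p") auto
  show "((\<lambda>t. \<beta> t j) \<longlongrightarrow> bo j) F" using L j by auto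
qed

theorem corollary1p9:
  fixes k p nm np :: nat
    and a b :: "nat \<Rightarrow> real"
    and s :: "int \<Rightarrow> real"
    and R :: "complex multiset"
    and r ss :: complex
  assumes "k \<ge> 3" and "k = 2 * p - 1 \<or> k = 2 * p"
    and "has_jost_roots k a b R"
    and "disc_roots (jost_function a b p) nm np s"
    and "resonance (jost_function a b p) r"
    and "(r \<notin> \<real> \<and> ss = cnj r) \<or>
         (\<exists>x j. r = complex_of_real x \<and> ss = complex_of_real (s j) \<and>
            ((2 \<le> j \<and> j \<le> int np - 1 \<and> inverse (s (j + 1)) < x \<and> x < inverse (s (j - 1))) \<or>
             (2 \<le> np \<and> j = int np \<and> 1 < x \<and> x < inverse (s (j - 1)))))"
  shows
    "(\<forall>t\<in>target_pairs nm np s. \<exists>a' b'.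
        has_jost_roots k a' b' (R - {#r, ss#} + {#fst t, snd t#})) \<and>
     (\<exists>ao bo. has_jost_roots (k - 2) ao bo (R - {#r, ss#})) \<and>
     (\<forall>ao bo at' bt'.
        has_jost_roots (k - 2) ao bo (R - {#r, ss#}) \<longrightarrow>
        (\<forall>t\<in>target_pairs nm np s.
           has_jost_roots k (at' t) (bt' t) (R - {#r, ss#} + {#fst t, snd t#})) \<longrightarrow>
        (k = 2 * p \<longrightarrow>
           (\<exists>\<epsilon>. (\<epsilon> \<longlongrightarrow> 0) (prod_at_infinity (target_pairs nm np s)) \<and>
              (\<forall>t\<in>target_pairs nm np s.
                 at' t p = 1 - (1 - (ao (p - 1))\<^sup>2 + \<epsilon> t) / (2 * pair_prod t)))) \<and>
        (k = 2 * p - 1 \<longrightarrow>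
           (\<forall>t\<in>target_pairs nm np s. bt' t p = bo (p - 1) / pair_prod t) \<and>
           ((\<lambda>t. bt' t p) \<longlongrightarrow> 0) (prod_at_infinity (target_pairs nm np s))) \<and>
        uniform_limit {1..} (\<lambda>t. perturbation (at' t) (bt' t)) (perturbation ao bo)
          (both_at_infinity (target_pairs nm np s)))"
proof -
  let ?T = "target_pairs nm np s"
  define Ro where "Ro = R - {#r, ss#}"
  have k1: "k \<ge> 1" "k - 2 \<ge> 1" using assms(1) by auto
  have pk: "(k + 1) div 2 = p" using assms(2) by auto
  obtain m where m: "p = Suc (Suc m)"
  proof -
    have "p \<ge> 2" using assms(1,2) by auto
    then show ?thesis using that[of "p - 2"] by simp
  qed
  have pk2: "(k - 2 + 1) div 2 = Suc m" using pk m assms(1) by simp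
  let ?P = "jost_function a b p"
  define g where "g = jost_poly a b p"
  note J = has_jost_rootsD[OF assms(3) k1(1), unfolded pk]
  note JR = has_jost_roots_degree[OF assms(3) k1(1), unfolded pk, folded g_def]
  have root_iff: "poly ?P z = 0 \<longleftrightarrow> poly (cpoly g) z = 0" for z
  proof -
    have "complex_of_real (inverse (\<Prod>i=1..p. a i)) \<noteq> 0"
      using J(8) by (simp only: of_real_eq_0_iff not_False_eq_True)
    then show ?thesis unfolding J(7) g_def poly_smult mult_eq_0_iff by blast
  qed
  have g0: "poly g 0 = 1" by (simp add: g_def)
  have gnz: "g \<noteq> 0" using g0 by auto
  have adm: "admissible g"
    unfolding g_def
  proof (rule jost_poly_admissible)
    fix z assume "norm z < 1" "poly (cpoly (jost_poly a b p)) z = 0"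
    then have "z \<in> {z. poly ?P z = 0 \<and> norm z < 1}" using root_iff by (simp add: g_def)
    then have "z \<in> (\<lambda>i. complex_of_real (s i)) ` ({- int nm..int np} - {0})"
      using assms(4) unfolding disc_roots_def by blast
    then show "z \<in> \<real>" by auto
  qed (use J(2) m in auto)
  have rP: "poly ?P r = 0" "norm r \<ge> 1" using assms(5) by (auto simp: resonance_def)
  note rem = removable_pair[OF assms(4) rP(2) assms(6)]
  have memR: "z \<in># R \<longleftrightarrow> poly ?P z = 0" for z
    using gnz J(6) root_iff[of z] by (auto simp: g_def)
  have ssP: "poly ?P ss = 0"
    using rem(3) rP(1) by (auto simp: root_iff poly_cpoly_cnj)
  have "{#r, ss#} \<subseteq># R"
    using rP(1) ssP rem(2) by (simp add: memR insert_subset_eq_iff in_diff_count)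
  then have Rsplit: "R = Ro + {#r, ss#}" unfolding Ro_def by (rule subset_mset.diff_add[symmetric])
  have nz0: "r \<noteq> 0" "ss \<noteq> 0" "0 \<notin># Ro" using JR(4) Rsplit by auto
  have size: "size Ro = k - 2" using JR(2) Rsplit by simp
  let ?c = "pair_poly (r, ss)"
  have c: "cpoly ?c = root_poly {#r, ss#}" using cpoly_pair_poly[OF rem(1)] by simp
  have cnz: "?c \<noteq> 0" using c by (metis cpoly_eq_0_iff root_poly_nonzero)
  have gR: "cpoly g = root_poly Ro * cpoly ?c" unfolding c root_poly_union[symmetric] Rsplit[symmetric] JR(3) ..
  obtain go where go: "root_poly Ro = cpoly go" using real_quotient[OF gR cnz] by blast
  have ggo: "g = ?c * go"
  proof -
    have "cpoly g = cpoly (?c * go)" unfolding gR go cpoly_mult by (rule mult.commute)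
    then show ?thesis by simp
  qed
  have go0: "poly go 0 = 1"
  proof -
    have "complex_of_real (poly go 0) = poly (cpoly go) (of_real 0)" by (simp only: poly_cpoly_of_real)
    also have "\<dots> = 1" unfolding go[symmetric] by simp
    finally show ?thesis by simp
  qed
  have go_root: "x \<noteq> 0 \<and> poly ?P (of_real x) = 0" if "poly go x = 0" for x
  proof -
    have "poly g x = 0" using that by (simp add: ggo)
    then show ?thesis using that go0 root_iff[of "of_real x"] by auto
  qed
  \<comment> \<open>Roots of \<open>go\<close> are roots of the Jost function, hence in the disc they are among the \<open>s i\<close>.\<close>
  have admo: "admissible go"
    using adm unfolding ggo
  proof (rule admissible_cofactor)
    fix x :: real assume "\<bar>x\<bar> < 1" "poly go x = 0"
    then show "poly ?c x * poly ?c (inverse x) \<ge> 0" using rem(4)[of x] go_root[of x] by blast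
  qed
  have dgo: "degree go = k - 2"
    using degree_root_poly[OF nz0(3)] size unfolding go by simp

  have exo: "\<exists>ao bo. has_jost_roots (k - 2) ao bo Ro"
    using admissible_imp_jost[OF admo go0 dgo k1(2) refl] proots_root_poly[OF nz0(3)] unfolding go by auto

  have ext: "\<exists>a' b'. has_jost_roots k a' b' (Ro + {#fst t, snd t#})" if t: "t \<in> ?T" for t
  proof -
    note T = target_pairD[OF assms(4) t]
    let ?g = "pair_poly t * go"
    have ct: "cpoly (pair_poly t) = root_poly {#fst t, snd t#}" by (rule cpoly_pair_poly[OF T(1)])
    have gt: "cpoly ?g = root_poly (Ro + {#fst t, snd t#})"
      unfolding cpoly_mult ct go[symmetric] root_poly_union by (rule mult.commute)
    have nz: "0 \<notin># Ro + {#fst t, snd t#}" using nz0(3) T(2,3) by auto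
    have "admissible ?g"
      using admo
    proof (rule admissible_mult)
      fix z :: complex assume z: "norm z \<le> 1"
      have "proots (cpoly (pair_poly t)) = {#fst t, snd t#}"
        unfolding ct by (rule proots_root_poly) (use T(2,3) in auto)
      then have "z \<notin># proots (cpoly (pair_poly t))" using z T(2,3) by auto
      moreover have "cpoly (pair_poly t) \<noteq> 0" unfolding ct by simp
      ultimately show "poly (cpoly (pair_poly t)) z \<noteq> 0" by simp
    next
      fix x :: real assume "\<bar>x\<bar> < 1" "poly go x = 0"
      then show "poly (pair_poly t) x * poly (pair_poly t) (inverse x) > 0"
        using T(4)[of x] go_root[of x] by blast
    qed
    moreover have "poly ?g 0 = 1" using go0 by (simp add: pair_poly_def)
    moreover have "degree ?g = k"
    proof -
      have "degree (cpoly ?g) = k" unfolding gt degree_root_poly[OF nz] using size assms(1) by simp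
      then show ?thesis by simp
    qed
    ultimately have "\<exists>a b. jost_poly a b p = ?g \<and> has_jost_roots k a b (proots (cpoly ?g))"
      using k1(1) pk by (intro admissible_imp_jost) auto
    then show ?thesis unfolding gt proots_root_poly[OF nz] by blast
  qed

  \<comment> \<open>For the asymptotics only the root multisets of the operators matter: by them the normalized Jost
    functions differ by the factor \<open>pair_poly t\<close>.\<close>
  have asym: "(k = 2 * p \<longrightarrow>
           (\<exists>\<epsilon>. (\<epsilon> \<longlongrightarrow> 0) (prod_at_infinity ?T) \<and>
              (\<forall>t\<in>?T. \<alpha> t p = 1 - (1 - (ao (p - 1))\<^sup>2 + \<epsilon> t) / (2 * pair_prod t)))) \<and>
        (k = 2 * p - 1 \<longrightarrow>
           (\<forall>t\<in>?T. \<beta> t p = bo (p - 1) / pair_prod t) \<and>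
           ((\<lambda>t. \<beta> t p) \<longlongrightarrow> 0) (prod_at_infinity ?T)) \<and>
        uniform_limit {1..} (\<lambda>t. perturbation (\<alpha> t) (\<beta> t)) (perturbation ao bo) (both_at_infinity ?T)"
    if Ho: "has_jost_roots (k - 2) ao bo Ro"
      and Ht: "\<forall>t\<in>?T. has_jost_roots k (\<alpha> t) (\<beta> t) (Ro + {#fst t, snd t#})" for ao bo \<alpha> \<beta>
  proof -
    note O = has_jost_rootsD[OF Ho k1(2), unfolded pk2]
    note OR = has_jost_roots_degree[OF Ho k1(2), unfolded pk2]
    define \<sigma> where "\<sigma> t = Re (inverse (fst t) + inverse (snd t))" for t :: "complex \<times> complex"
    define \<mu> where "\<mu> t = inverse (pair_prod t)" for t
    have Jt: "jost_poly (\<alpha> t) (\<beta> t) (Suc (Suc m)) = [:1, - \<sigma> t, \<mu> t:] * jost_poly ao bo (Suc m)" if t: "t \<in> ?T" for t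
    proof -
      note TR = has_jost_roots_degree[OF Ht[rule_format, OF t] k1(1), unfolded pk m]
      have "cpoly (jost_poly (\<alpha> t) (\<beta> t) (Suc (Suc m))) = cpoly (pair_poly t * jost_poly ao bo (Suc m))"
        unfolding TR(3)[symmetric] root_poly_union OR(3) cpoly_mult
          cpoly_pair_poly[OF target_pairD(1)[OF assms(4) t]] by (rule mult.commute)
      then show ?thesis by (simp only: cpoly_inject pair_poly_def \<sigma>_def \<mu>_def)
    qed
    have apos: "\<alpha> t i > 0" if "t \<in> ?T" "i \<ge> 1" for t i
      using has_jost_rootsD(2)[OF Ht[rule_format, OF that(1)] k1(1) that(2)] .
    have real_prod: "fst t * snd t \<in> \<real>" if t: "t \<in> ?T" for t
      using target_pairD(1)[OF assms(4) t] by (auto simp: real_pair_def complex_is_Real_iff)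
    have pp: "pair_prod t \<noteq> 0" if t: "t \<in> ?T" for t
    proof -
      note T = target_pairD[OF assms(4) t]
      have "fst t * snd t \<noteq> 0" using T(2,3) by auto
      then show ?thesis using real_prod[OF t] unfolding pair_prod_def by (metis of_real_0 of_real_Re)
    qed
    have A: "\<exists>\<epsilon>. (\<epsilon> \<longlongrightarrow> 0) (prod_at_infinity ?T) \<and>
       (\<forall>t\<in>?T. \<alpha> t p = 1 - (1 - (ao (p - 1))\<^sup>2 + \<epsilon> t) / (2 * pair_prod t))"
    proof (rule last_a_asymptotics)
      show "(\<alpha> t p)\<^sup>2 = 1 - (1 - (ao (p - 1))\<^sup>2) * inverse (pair_prod t)" if "t \<in> ?T" for t
        using last_coeff_a[OF Jt[OF that]] by (simp add: m \<mu>_def)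
    qed (use apos pp m in auto)
    have B: "(\<forall>t\<in>?T. \<beta> t p = bo (p - 1) / pair_prod t) \<and> ((\<lambda>t. \<beta> t p) \<longlongrightarrow> 0) (prod_at_infinity ?T)"
      if k: "k = 2 * p - 1"
    proof -
      have odd: "odd k" "odd (k - 2)" using k m by auto
      have bt: "\<beta> t p = bo (p - 1) * inverse (pair_prod t)" if t: "t \<in> ?T" for t
      proof -
        have "\<alpha> t (Suc (Suc m)) = 1"
          using has_jost_rootsD(5)[OF Ht[rule_format, OF t] k1(1) odd(1)] pk m by simp
        then show ?thesis using last_coeff_b[OF Jt[OF t]] O(5)[OF odd(2)] by (simp add: m \<mu>_def)
      qed
      have "((\<lambda>t. bo (p - 1) * inverse (pair_prod t)) \<longlongrightarrow> bo (p - 1) * 0) (prod_at_infinity ?T)"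
        by (intro tendsto_intros pair_prod_tendsto)
      then have "((\<lambda>t. bo (p - 1) * inverse (pair_prod t)) \<longlongrightarrow> 0) (prod_at_infinity ?T)" by simp
      moreover have "eventually (\<lambda>t. bo (p - 1) * inverse (pair_prod t) = \<beta> t p) (prod_at_infinity ?T)"
        unfolding prod_at_infinity_def eventually_inf_principal by (rule always_eventually) (simp add: bt)
      ultimately have "((\<lambda>t. \<beta> t p) \<longlongrightarrow> 0) (prod_at_infinity ?T)" by (rule Lim_transform_eventually)
      then show ?thesis using bt by (simp add: divide_inverse)
    qed
    let ?F = "both_at_infinity ?T"
    have inT: "eventually (\<lambda>t. t \<in> ?T) ?F"
      unfolding both_at_infinity_def eventually_inf_principal by (rule always_eventually) simp
    have s0: "(\<sigma> \<longlongrightarrow> 0) ?F"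
      using tendsto_Re[OF tendsto_add[OF both_at_infinity_tendsto(1,2)]] unfolding \<sigma>_def by simp
    have m0: "(\<mu> \<longlongrightarrow> 0) ?F"
    proof (rule Lim_transform_eventually)
      show "((\<lambda>t. Re (inverse (fst t) * inverse (snd t))) \<longlongrightarrow> 0) ?F"
        using tendsto_Re[OF tendsto_mult[OF both_at_infinity_tendsto(1,2)]] by simp
      show "eventually (\<lambda>t. Re (inverse (fst t) * inverse (snd t)) = \<mu> t) ?F"
        using inT
      proof (rule eventually_mono)
        fix t assume "t \<in> ?T"
        then obtain v where v: "fst t * snd t = of_real v" using real_prod Reals_cases by metis
        have "inverse (fst t) * inverse (snd t) = of_real (inverse v)"
          using v by (metis inverse_mult_distrib of_real_inverse)
        then show "Re (inverse (fst t) * inverse (snd t)) = \<mu> t"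
          by (simp only: \<mu>_def pair_prod_def v Re_complex_of_real)
      qed
    qed
    have ev: "eventually (\<lambda>t. (\<forall>i\<ge>1. \<alpha> t i > 0) \<and>
      jost_poly (\<alpha> t) (\<beta> t) (Suc (Suc m)) = [:1, - \<sigma> t, \<mu> t:] * jost_poly ao bo (Suc m)) ?F"
      using inT by (rule eventually_mono) (use apos Jt in blast)
    have lims: "((\<lambda>t. \<alpha> t j) \<longlongrightarrow> ao j) ?F" "((\<lambda>t. \<beta> t j) \<longlongrightarrow> bo j) ?F" if "1 \<le> j" "j \<le> Suc (Suc m)" for j
      using jacobi_coeffs_tendsto[OF O(2) _ _ ev s0 m0 that] O(3,4)[of "Suc (Suc m)"] by auto
    have plim: "((\<lambda>t. perturbation (\<alpha> t) (\<beta> t) x) \<longlongrightarrow> perturbation ao bo x) ?F" if x: "x \<in> {1..k}" for x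
    proof (cases "even x")
      case True
      then have "1 \<le> x div 2" "x div 2 \<le> Suc (Suc m)" using x pk m by auto
      then show ?thesis using True lims(1)[of "x div 2"] by (auto simp: perturbation_def intro!: tendsto_diff)
    next
      case False
      have "(1 + 1) div 2 \<le> (x + 1) div 2" using x by (intro div_le_mono) auto
      then have "1 \<le> (x + 1) div 2" by simp
      moreover have "(x + 1) div 2 \<le> (k + 1) div 2" using x by (intro div_le_mono) auto
      then have "(x + 1) div 2 \<le> Suc (Suc m)" unfolding pk m .
      ultimately show ?thesis using False lims(2)[of "(x + 1) div 2"] by (simp add: perturbation_def)
    qed
    have "uniform_limit {1..} (\<lambda>t. perturbation (\<alpha> t) (\<beta> t)) (perturbation ao bo) ?F"
      unfolding uniform_limit_iff
    proof (intro allI impI)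
      fix e :: real assume e: "e > 0"
      have "eventually (\<lambda>t. \<forall>x\<in>{1..k}. dist (perturbation (\<alpha> t) (\<beta> t) x) (perturbation ao bo x) < e) ?F"
        by (rule eventually_ball_finite) (use plim e in \<open>auto intro: tendstoD\<close>)
      with inT show "eventually (\<lambda>t. \<forall>x\<in>{1..}. dist (perturbation (\<alpha> t) (\<beta> t) x) (perturbation ao bo x) < e) ?F"
      proof eventually_elim
        case (elim t)
        show ?case
        proof
          fix x :: nat assume x: "x \<in> {1..}"
          show "dist (perturbation (\<alpha> t) (\<beta> t) x) (perturbation ao bo x) < e"
          proof (cases "x \<le> k")
            case True
            then show ?thesis using elim(2) x by auto
          next
            case False
            then have "perturbation (\<alpha> t) (\<beta> t) x = 0" "perturbation ao bo x = 0"
              using has_jost_rootsD(9)[OF Ht[rule_format, OF elim(1)] k1(1)] O(9)[of x] by auto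
            then show ?thesis using e by simp
          qed
        qed
      qed
    qed
    then show ?thesis using A B by blast
  qed
  show ?thesis
    using ext exo asym unfolding Ro_def by blast
qed

end
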